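(* Let $G$ be a finite simple graph on the vertex set $[n]$, let $K$ be a field and $S=K[x_1,\dots,x_n]$. The following conditions are equivalent: (a) $I_c(G)^k$ has linear resolution, for some $k\ge1$ (equivalently, for all $k\ge1$); (b) $I_c(G)^k$ has linear quotients, for some $k\ge1$ (equivalently, for all $k\ge1$); (c) $c(G)=1$.
   Context: $[n]=\{1,\dots,n\}$; $G$ has edge set $E(G)$ and may have isolated vertices. The complementary edge ideal of $G$ is $I_c(G)=\big((x_1\cdots x_n)/(x_ix_j) : \{i,j\}\in E(G)\big)\subset S$ (with $I_c(G)=(0)$ if $E(G)$ is empty). $c(G)$ denotes the number of connected components of $G$ which are not isolated vertices. A homogeneous ideal $I$ of the standard graded ring $S$ has linear resolution if it is generated in a single degree $d$ and, for all $i>0$, its $i$th syzygy module is either zero or generated in degree $d+i$. A monomial ideal $I$ with minimal monomial generating set $\mathcal{G}(I)$ has linear quotients if there is an order $u_1,\dots,u_m$ of $\mathcal{G}(I)$ such that $(u_1,\dots,u_{i-1}):(u_i)$ is generated by variables for all $i=2,\dots,m$. *)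

theory Defs
  imports Complex_Main "HOL-Library.Poly_Mapping" "HOL-Library.Function_Algebras"
begin

section \<open>The polynomial ring and its ideals\<close>

text \<open>
  A finite type \<open>'n\<close> indexes the variables, so that \<open>[n]\<close> is \<open>UNIV :: 'n set\<close>, with
  \<open>n = CARD('n)\<close>. The ring \<open>S\<close> is the monoid algebra of the exponent vectors, with the
  convolution product of \<^theory>\<open>HOL-Library.Poly_Mapping\<close>.
\<close>

type_synonym ('n, 'k) polyring = "('n \<Rightarrow>\<^sub>0 nat) \<Rightarrow>\<^sub>0 'k"

definition var :: "'n \<Rightarrow> ('n, 'k::comm_ring_1) polyring" where
  "var v = Poly_Mapping.single (Poly_Mapping.single v 1) 1"

definition monomials :: "('n, 'k::comm_ring_1) polyring set" where
  "monomials = range (\<lambda>t. Poly_Mapping.single t 1)"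

definition total_degree :: "('n::finite \<Rightarrow>\<^sub>0 nat) \<Rightarrow> nat" where
  "total_degree t = (\<Sum>v\<in>UNIV. Poly_Mapping.lookup t v)"

text \<open>A commutative ring as a module over itself: \<open>ideal.span B\<close> is the ideal generated by \<open>B\<close>.\<close>

interpretation ideal: module "(*) :: 'a::comm_ring_1 \<Rightarrow> 'a \<Rightarrow> 'a"
  by unfold_locales (simp_all add: algebra_simps)

declare ideal.scale_scale [simp del] \<comment> \<open>loops with \<open>mult.assoc\<close>\<close>

definition ideal_mult :: "'a::comm_ring_1 set \<Rightarrow> 'a set \<Rightarrow> 'a set" where
  "ideal_mult I J = ideal.span {a * b | a b. a \<in> I \<and> b \<in> J}"

primrec ideal_power :: "'a::comm_ring_1 set \<Rightarrow> nat \<Rightarrow> 'a set" where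
  "ideal_power I 0 = UNIV"
| "ideal_power I (Suc k) = ideal_mult I (ideal_power I k)"

definition ideal_colon :: "'a::comm_ring_1 set \<Rightarrow> 'a set \<Rightarrow> 'a set" where
  "ideal_colon I J = {f. \<forall>g\<in>J. f * g \<in> I}"


section \<open>Linear quotients\<close>

definition minimal_monomial_generators ::
  "('n, 'k::comm_ring_1) polyring set \<Rightarrow> ('n, 'k) polyring set \<Rightarrow> bool" where
  "minimal_monomial_generators I B \<longleftrightarrow>
     B \<subseteq> monomials \<and> ideal.span B = I \<and> (\<forall>u\<in>B. u \<notin> ideal.span (B - {u}))"

text \<open>
  The list \<open>us\<close> is indexed from 0. Requiring \<open>us \<noteq> []\<close> (that is, \<open>m \<ge> 1\<close>) excludes exactly
  the zero ideal.
\<close>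

definition has_linear_quotients :: "('n, 'k::comm_ring_1) polyring set \<Rightarrow> bool" where
  "has_linear_quotients I \<longleftrightarrow>
     (\<exists>us. us \<noteq> [] \<and> distinct us \<and> minimal_monomial_generators I (set us) \<and>
        (\<forall>i. 1 \<le> i \<and> i < length us \<longrightarrow>
           (\<exists>V. ideal_colon (ideal.span (set (take i us))) (ideal.span {us ! i})
                  = ideal.span (var ` V))))"


section \<open>Graded free modules, syzygies and linear resolutions\<close>

text \<open>
  For a list \<open>a\<close> of degrees, the graded free module \<open>\<Oplus>\<^sub>j S(- a\<^sub>j)\<close> consists of the
  functions \<open>f :: nat \<Rightarrow> S\<close> with \<open>f j = 0\<close> for \<open>j \<ge> length a\<close>; its \<open>j\<close>-th basis vector has
  degree \<open>a ! j\<close>. Submodules are submodules of \<open>nat \<Rightarrow> S\<close> under componentwise scaling, and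
  \<open>free.span B\<close> is the submodule generated by \<open>B\<close>.
\<close>

definition vscale :: "'a::comm_ring_1 \<Rightarrow> (nat \<Rightarrow> 'a) \<Rightarrow> (nat \<Rightarrow> 'a)" where
  "vscale c f = (\<lambda>j. c * f j)"

interpretation free: module "vscale :: 'a::comm_ring_1 \<Rightarrow> (nat \<Rightarrow> 'a) \<Rightarrow> (nat \<Rightarrow> 'a)"
  by unfold_locales (simp_all add: vscale_def fun_eq_iff algebra_simps)

text \<open>Zero is homogeneous of every degree.\<close>

definition homogeneous_vec ::
  "nat list \<Rightarrow> nat \<Rightarrow> (nat \<Rightarrow> ('n::finite, 'k::comm_ring_1) polyring) \<Rightarrow> bool" where
  "homogeneous_vec a e f \<longleftrightarrow>
     (\<forall>j < length a. \<forall>t \<in> Poly_Mapping.keys (f j). total_degree t + a ! j = e) \<and>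
     (\<forall>j \<ge> length a. f j = 0)"

text \<open>As usual, only a nonzero module counts as generated in degree \<open>e\<close>.\<close>

definition generated_in_degree ::
  "nat list \<Rightarrow> (nat \<Rightarrow> ('n::finite, 'k::comm_ring_1) polyring) set \<Rightarrow> nat \<Rightarrow> bool" where
  "generated_in_degree a M e \<longleftrightarrow>
     M \<noteq> {0} \<and> M = free.span {f \<in> M. homogeneous_vec a e f}"

text \<open>
  \<open>gs\<close> is an irredundant system of homogeneous generators of \<open>M\<close>, with degrees \<open>b\<close>. For a
  graded module over \<open>S\<close> irredundant systems of homogeneous generators are minimal ones.
\<close>

definition minimal_homogeneous_generators ::
  "nat list \<Rightarrow> (nat \<Rightarrow> ('n::finite, 'k::comm_ring_1) polyring) set \<Rightarrow>
   (nat \<Rightarrow> ('n, 'k) polyring) list \<Rightarrow> nat list \<Rightarrow> bool" where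
  "minimal_homogeneous_generators a M gs b \<longleftrightarrow>
     length gs = length b \<and>
     (\<forall>i < length gs. homogeneous_vec a (b ! i) (gs ! i)) \<and>
     free.span (set gs) = M \<and>
     (\<forall>i < length gs. gs ! i \<notin> free.span (set (take i gs @ drop (Suc i) gs)))"

definition relation_module :: "(nat \<Rightarrow> 'a::comm_ring_1) list \<Rightarrow> (nat \<Rightarrow> 'a) set" where
  "relation_module gs =
     {f. (\<forall>i \<ge> length gs. f i = 0) \<and> (\<Sum>i < length gs. vscale (f i) (gs ! i)) = 0}"

text \<open>
  A minimal graded free resolution \<open>\<dots> \<rightarrow> F\<^sub>1 \<rightarrow> F\<^sub>0 \<rightarrow> I \<rightarrow> 0\<close> of an ideal \<open>I \<subseteq> S = S(0)\<close> is
  recorded by the degrees \<open>a (Suc i)\<close> of the basis of \<open>F\<^sub>i\<close> and the images \<open>g i\<close> of that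
  basis in \<open>F\<^sub>i\<^sub>-\<^sub>1\<close> (in \<open>S\<close> if \<open>i = 0\<close>, whence \<open>a 0 = [0]\<close>). The \<open>i\<close>-th syzygy
  module is the image of \<open>F\<^sub>i\<close>; it is \<open>I\<close> itself for \<open>i = 0\<close>. Minimal graded free resolutions
  exist and are unique up to isomorphism.
\<close>

primrec syzygy_module ::
  "'a::comm_ring_1 set \<Rightarrow> (nat \<Rightarrow> (nat \<Rightarrow> 'a) list) \<Rightarrow> nat \<Rightarrow> (nat \<Rightarrow> 'a) set" where
  "syzygy_module I g 0 = {f. f 0 \<in> I \<and> (\<forall>j > 0. f j = 0)}"
| "syzygy_module I g (Suc i) = relation_module (g i)"

definition minimal_graded_free_resolution ::
  "('n::finite, 'k::comm_ring_1) polyring set \<Rightarrow> (nat \<Rightarrow> nat list) \<Rightarrow>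
   (nat \<Rightarrow> (nat \<Rightarrow> ('n, 'k) polyring) list) \<Rightarrow> bool" where
  "minimal_graded_free_resolution I a g \<longleftrightarrow>
     a 0 = [0] \<and>
     (\<forall>i. minimal_homogeneous_generators (a i) (syzygy_module I g i) (g i) (a (Suc i)))"

definition has_linear_resolution :: "('n::finite, 'k::comm_ring_1) polyring set \<Rightarrow> bool" where
  "has_linear_resolution I \<longleftrightarrow>
     (\<exists>a g. minimal_graded_free_resolution I a g \<and>
        (\<exists>d. generated_in_degree (a 0) (syzygy_module I g 0) d \<and>
             (\<forall>i > 0. syzygy_module I g i = {0} \<or>
                      generated_in_degree (a i) (syzygy_module I g i) (d + i))))"


section \<open>Graphs and complementary edge ideals\<close>

text \<open>A simple graph on the vertex set \<open>UNIV :: 'n set\<close> is given by its set of edges.\<close>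

definition simple_graph :: "'n set set \<Rightarrow> bool" where
  "simple_graph E \<longleftrightarrow> (\<forall>e\<in>E. card e = 2)"

definition adjacency :: "'n set set \<Rightarrow> ('n \<times> 'n) set" where
  "adjacency E = {(i, j). {i, j} \<in> E}"

definition connected_components :: "'n set set \<Rightarrow> 'n set set" where
  "connected_components E = UNIV // (adjacency E)\<^sup>*"

definition isolated_vertex :: "'n set set \<Rightarrow> 'n \<Rightarrow> bool" where
  "isolated_vertex E v \<longleftrightarrow> (\<forall>e\<in>E. v \<notin> e)"

text \<open>The number \<open>c(G)\<close>.\<close>

definition num_nonisolated_components :: "'n set set \<Rightarrow> nat" where
  "num_nonisolated_components E =
     card {C \<in> connected_components E. \<not> (\<exists>v. isolated_vertex E v \<and> C = {v})}"

text \<open>For an edge \<open>e = {i, j}\<close>, the quotient \<open>(x\<^sub>1\<cdots>x\<^sub>n)/(x\<^sub>ix\<^sub>j)\<close> is the product of the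
  variables outside \<open>e\<close>.\<close>

definition complementary_edge_ideal :: "'n::finite set set \<Rightarrow> ('n, 'k::comm_ring_1) polyring set" where
  "complementary_edge_ideal E = ideal.span ((\<lambda>e. \<Prod>v\<in>UNIV - e. var v) ` E)"

end

theory Submission
  imports Defs "HOL-Library.Multiset"
begin

text \<open>
  The power \<open>I\<^sup>k\<close> is generated by the monomials in which a variable \<open>v\<close> has exponent
  \<open>k - d v\<close>, where \<open>d\<close> is the degree sequence of a multiset of \<open>k\<close> edges. They all have the
  same degree, so they are the minimal generators, and every condition is a statement about such
  degree sequences.

  Let the nonisolated vertices form one component. Degree sequences satisfy the two-step axiom of
  jump systems (\<open>degree_jump\<close>): a step from \<open>d\<close> towards \<open>d'\<close> can be completed by a second
  one to a degree sequence. Rank the vertices so that each nonisolated vertex except a root has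
  a neighbour of smaller rank, and compare degree sequences at the vertex of largest rank where they differ.
  If \<open>d'\<close> precedes \<open>d\<close> and \<open>v\<close> is that vertex, the two steps from \<open>d\<close> can be arranged to
  lower \<open>d v\<close> and to raise the degree of a vertex of smaller rank (\<open>degree_exchange\<close>). The
  resulting sequence precedes \<open>d\<close>, and its monomial divides \<open>x\<^sub>v\<close> times that of \<open>d\<close>, while
  \<open>x\<^sub>v\<close> divides each multiplier that carries the monomial of \<open>d\<close> into the ideal of that of \<open>d'\<close>:
  this is what linear quotients ask for.

  Linear quotients of generators of one degree pass to syzygies: if \<open>m\<^sub>0, m\<^sub>1, \<dots>\<close> are vectors
  whose successive colon ideals are generated by sets \<open>V\<^sub>i\<close> of variables, then the relation
  module is generated by one linear relation for each \<open>i\<close> and each variable in \<open>V\<^sub>i\<close>, and these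
  relations again have linear quotients (\<open>linear_quotient_list_syzygies\<close>). Iterating produces the
  minimal resolution, and it is linear.

  Finally, let \<open>C\<close> be a component that contains an edge \<open>e\<close> but misses an edge \<open>f\<close>. Grade the
  polynomial ring by the degree in the variables of \<open>C\<close>. A multiset with \<open>q\<close> edges inside \<open>C\<close>
  gives a generator of degree \<open>k * card C - 2 * q\<close>, so the degrees of two generators cannot
  differ by one. Hence in a relation with linear coefficients the generators of the lowest degree
  cancel among themselves. This persists for all combinations of linear relations, but it fails
  for the Koszul relation between the generators belonging to \<open>k\<close> times \<open>e\<close> and \<open>k\<close> times
  \<open>f\<close>. So the resolution is not linear (\<open>split_generators_imp_no_linear_resolution\<close>).
\<close>

section \<open>Polynomials and monomial ideals\<close>

abbreviation mon :: "('n \<Rightarrow>\<^sub>0 nat) \<Rightarrow> ('n, 'k::comm_ring_1) polyring" where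
  "mon t \<equiv> Poly_Mapping.single t 1"

definition restrict_keys :: "('a \<Rightarrow> bool) \<Rightarrow> ('a \<Rightarrow>\<^sub>0 'b::zero) \<Rightarrow> ('a \<Rightarrow>\<^sub>0 'b)" where
  "restrict_keys P f = Abs_poly_mapping (\<lambda>t. Poly_Mapping.lookup f t when P t)"

lemma lookup_restrict_keys:
  "Poly_Mapping.lookup (restrict_keys P f) t = (Poly_Mapping.lookup f t when P t)"
proof -
  have "finite {t. (Poly_Mapping.lookup f t when P t) \<noteq> 0}"
    by (rule finite_subset[of _ "Poly_Mapping.keys f"])
      (auto simp: in_keys_iff when_def split: if_splits)
  then show ?thesis unfolding restrict_keys_def by simp
qed

lemma keys_restrict_keys: "Poly_Mapping.keys (restrict_keys P f) = {t \<in> Poly_Mapping.keys f. P t}"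
  by (auto simp: in_keys_iff lookup_restrict_keys when_def split: if_splits)

lemma keys_empty_iff: "Poly_Mapping.keys f = {} \<longleftrightarrow> f = 0"
  by (auto simp: poly_mapping_eq_iff fun_eq_iff in_keys_iff set_eq_iff)

lemma restrict_keys_zero [simp]: "restrict_keys P 0 = 0"
  by (rule poly_mapping_eqI) (simp add: lookup_restrict_keys)

lemma restrict_keys_add: "restrict_keys P (f + g) = restrict_keys P f + restrict_keys P g"
  by (rule poly_mapping_eqI) (simp add: lookup_restrict_keys lookup_add when_add_distrib)

lemma restrict_keys_sum: "restrict_keys P (sum f A) = (\<Sum>x\<in>A. restrict_keys P (f x))"
  by (induction A rule: infinite_finite_induct) (auto simp: restrict_keys_add)

lemma restrict_keys_single:
  "restrict_keys P (Poly_Mapping.single t c) = (if P t then Poly_Mapping.single t c else 0)"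
  by (rule poly_mapping_eqI) (simp add: lookup_restrict_keys lookup_single when_def)

lemma restrict_keys_id: "(\<And>t. t \<in> Poly_Mapping.keys f \<Longrightarrow> P t) \<Longrightarrow> restrict_keys P f = f"
  by (rule poly_mapping_eqI) (auto simp: lookup_restrict_keys in_keys_iff when_def)

lemma poly_mapping_sum_single:
  fixes f :: "'a \<Rightarrow>\<^sub>0 'b::comm_monoid_add"
  shows "f = (\<Sum>t\<in>Poly_Mapping.keys f. Poly_Mapping.single t (Poly_Mapping.lookup f t))"
proof (rule poly_mapping_eqI)
  fix k
  have "(\<Sum>t\<in>Poly_Mapping.keys f. Poly_Mapping.lookup f t when t = k) = Poly_Mapping.lookup f k"
    by (simp add: when_def sum.delta' in_keys_iff)
  then show "Poly_Mapping.lookup f k = Poly_Mapping.lookup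
      (\<Sum>t\<in>Poly_Mapping.keys f. Poly_Mapping.single t (Poly_Mapping.lookup f t)) k"
    by (simp add: lookup_sum lookup_single)
qed

lemma times_eq_sum_single:
  fixes f g :: "('n, 'k::comm_ring_1) polyring"
  shows "f * g = (\<Sum>s\<in>Poly_Mapping.keys f. \<Sum>t\<in>Poly_Mapping.keys g.
           Poly_Mapping.single (s + t) (Poly_Mapping.lookup f s * Poly_Mapping.lookup g t))"
proof -
  have "f * g = (\<Sum>s\<in>Poly_Mapping.keys f. Poly_Mapping.single s (Poly_Mapping.lookup f s)) *
      (\<Sum>t\<in>Poly_Mapping.keys g. Poly_Mapping.single t (Poly_Mapping.lookup g t))"
    by (simp flip: poly_mapping_sum_single)
  then show ?thesis by (simp add: sum_product mult_single)
qed

text \<open>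
  A product is compatible with restriction to a set of exponents as soon as membership of a sum
  \<open>s + t\<close> can be decided by testing \<open>s\<close> and \<open>t\<close> separately. With a
  condition on degrees this extracts homogeneous components; other conditions cut off a grading at
  a bound.
\<close>

lemma restrict_keys_times:
  fixes f g :: "('n, 'k::comm_ring_1) polyring"
  assumes "\<And>s t. s \<in> Poly_Mapping.keys f \<Longrightarrow> t \<in> Poly_Mapping.keys g \<Longrightarrow> P (s + t) \<longleftrightarrow> Q s \<and> R t"
  shows "restrict_keys P (f * g) = restrict_keys Q f * restrict_keys R g"
proof -
  let ?term = "\<lambda>s t. Poly_Mapping.single (s + t) (Poly_Mapping.lookup f s * Poly_Mapping.lookup g t)"
  have "restrict_keys P (f * g) =
      (\<Sum>s\<in>Poly_Mapping.keys f. \<Sum>t\<in>Poly_Mapping.keys g. if Q s \<and> R t then ?term s t else 0)"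
    using assms by (subst times_eq_sum_single)
      (auto simp: restrict_keys_sum restrict_keys_single intro!: sum.cong)
  also have "\<dots> = (\<Sum>s\<in>Poly_Mapping.keys f. \<Sum>t\<in>Poly_Mapping.keys g.
        restrict_keys Q (Poly_Mapping.single s (Poly_Mapping.lookup f s)) *
        restrict_keys R (Poly_Mapping.single t (Poly_Mapping.lookup g t)))"
    by (intro sum.cong refl) (auto simp: restrict_keys_single mult_single)
  also have "\<dots> = restrict_keys Q f * restrict_keys R g"
    by (simp add: sum_product[symmetric] restrict_keys_sum[symmetric] poly_mapping_sum_single[symmetric])
  finally show ?thesis .
qed

lemma keys_times_subset:
  fixes f g :: "('n, 'k::comm_ring_1) polyring"
  assumes "t \<in> Poly_Mapping.keys (f * g)"
  obtains r s where "t = r + s" "r \<in> Poly_Mapping.keys f" "s \<in> Poly_Mapping.keys g"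
  using assms keys_mult[of f g] by blast

lemma lookup_times_mon:
  fixes f :: "('n, 'k::comm_ring_1) polyring"
  shows "Poly_Mapping.lookup (f * mon t) (s + t) = Poly_Mapping.lookup f s"
proof -
  have "f * mon t = (\<Sum>r\<in>Poly_Mapping.keys f. Poly_Mapping.single (r + t) (Poly_Mapping.lookup f r))"
    by (simp add: times_eq_sum_single[of f "mon t"])
  then have "Poly_Mapping.lookup (f * mon t) (s + t) =
      (\<Sum>r\<in>Poly_Mapping.keys f. Poly_Mapping.lookup f r when r = s)"
    by (simp add: lookup_sum lookup_single)
  also have "\<dots> = Poly_Mapping.lookup f s"
    by (simp add: when_def sum.delta' in_keys_iff)
  finally show ?thesis .
qed

lemma keys_times_mon:
  fixes f :: "('n, 'k::comm_ring_1) polyring"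
  shows "s \<in> Poly_Mapping.keys f \<Longrightarrow> s + t \<in> Poly_Mapping.keys (f * mon t)"
  by (simp add: in_keys_iff lookup_times_mon)

lemma times_mon_eq_0_iff:
  fixes f :: "('n, 'k::comm_ring_1) polyring"
  shows "f * mon t = 0 \<longleftrightarrow> f = 0"
proof
  assume "f * mon t = 0"
  then have "Poly_Mapping.keys f = {}" using keys_times_mon[of _ f t] by fastforce
  then show "f = 0" by (simp add: keys_empty_iff)
qed simp

lemma mon_eq_iff: "(mon s :: ('n, 'k::comm_ring_1) polyring) = mon t \<longleftrightarrow> s = t"
  using lookup_single_eq[of s "1::'k"] lookup_single_not_eq[of t s "1::'k"] by fastforce

lemma mon_in_span:
  assumes "s \<in> A" "t = s + r"
  shows "(mon t :: ('n, 'k::comm_ring_1) polyring) \<in> ideal.span (mon ` A)"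
proof -
  have "mon r * mon s \<in> (ideal.span (mon ` A) :: ('n, 'k) polyring set)"
    using assms(1) by (intro ideal.span_scale ideal.span_base) simp
  then show ?thesis using assms(2) by (simp add: mult_single add.commute)
qed

lemma mem_monomial_ideal_iff:
  fixes f :: "('n, 'k::comm_ring_1) polyring"
  shows "f \<in> ideal.span (mon ` A) \<longleftrightarrow> (\<forall>t\<in>Poly_Mapping.keys f. \<exists>s\<in>A. \<exists>r. t = s + r)"
proof
  assume "f \<in> ideal.span (mon ` A)"
  then show "\<forall>t\<in>Poly_Mapping.keys f. \<exists>s\<in>A. \<exists>r. t = s + r"
  proof (induction rule: ideal.span_induct_alt)
    case (step c x y)
    show ?case
    proof
      fix t assume "t \<in> Poly_Mapping.keys (c * x + y)"
      then consider "t \<in> Poly_Mapping.keys (c * x)" | "t \<in> Poly_Mapping.keys y"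
        using keys_add[of "c * x" y] by blast
      then show "\<exists>s\<in>A. \<exists>r. t = s + r"
      proof cases
        case 1
        then obtain r s where "t = r + s" "s \<in> Poly_Mapping.keys x" by (rule keys_times_subset)
        with step.hyps have "s \<in> A" "t = s + r" by (auto simp: add.commute)
        then show ?thesis by blast
      qed (use step.IH in blast)
    qed
  qed simp
next
  assume *: "\<forall>t\<in>Poly_Mapping.keys f. \<exists>s\<in>A. \<exists>r. t = s + r"
  have "Poly_Mapping.single 0 (Poly_Mapping.lookup f t) * mon t \<in> ideal.span (mon ` A)"
    if "t \<in> Poly_Mapping.keys f" for t
    using * that mon_in_span by (blast intro: ideal.span_scale)
  then have "(\<Sum>t\<in>Poly_Mapping.keys f. Poly_Mapping.single t (Poly_Mapping.lookup f t)) \<in> ideal.span (mon ` A)"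
    by (intro ideal.span_sum) (simp add: mult_single)
  then show "f \<in> ideal.span (mon ` A)"
    using poly_mapping_sum_single[of f] by simp
qed

lemma mon_mem_monomial_ideal_iff:
  "(mon t :: ('n, 'k::comm_ring_1) polyring) \<in> ideal.span (mon ` A) \<longleftrightarrow> (\<exists>s\<in>A. \<exists>r. t = s + r)"
  by (simp add: mem_monomial_ideal_iff)

lemma pos_lookup_iff: "0 < Poly_Mapping.lookup t v \<longleftrightarrow> (\<exists>r. t = Poly_Mapping.single v (1::nat) + r)"
proof
  assume "0 < Poly_Mapping.lookup t v"
  then have "t = Poly_Mapping.single v 1 + (t - Poly_Mapping.single v 1)"
    by (intro poly_mapping_eqI) (auto simp: lookup_add lookup_minus lookup_single when_def)
  then show "\<exists>r. t = Poly_Mapping.single v (1::nat) + r" by blast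
qed (auto simp: lookup_add)

lemma mem_span_var_iff:
  fixes f :: "('n, 'k::comm_ring_1) polyring"
  shows "f \<in> ideal.span (var ` V) \<longleftrightarrow> (\<forall>t\<in>Poly_Mapping.keys f. \<exists>v\<in>V. 0 < Poly_Mapping.lookup t v)"
proof -
  have "var ` V = (mon ` ((\<lambda>v. Poly_Mapping.single v 1) ` V) :: ('n, 'k) polyring set)"
    by (auto simp: var_def image_iff)
  then show ?thesis by (simp add: mem_monomial_ideal_iff pos_lookup_iff)
qed

text \<open>A variable outside \<open>W\<close> does not help a monomial to become divisible by one in \<open>W\<close>.\<close>

lemma var_times_mem_span_var:
  fixes h :: "('n, 'k::comm_ring_1) polyring"
  assumes "h * var x \<in> ideal.span (var ` W)" and "x \<notin> W"
  shows "h \<in> ideal.span (var ` W)"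
  unfolding mem_span_var_iff
proof
  fix s assume "s \<in> Poly_Mapping.keys h"
  then have "s + Poly_Mapping.single x 1 \<in> Poly_Mapping.keys (h * var x)"
    unfolding var_def by (rule keys_times_mon)
  with assms(1) obtain v where "v \<in> W" "0 < Poly_Mapping.lookup (s + Poly_Mapping.single x 1) v"
    unfolding mem_span_var_iff by blast
  with assms(2) show "\<exists>v\<in>W. 0 < Poly_Mapping.lookup s v"
    by (intro bexI[of _ v]) (auto simp: lookup_add lookup_single when_def split: if_splits)
qed

lemma total_degree_add [simp]: "total_degree (s + t) = total_degree s + total_degree t"
  by (simp add: total_degree_def lookup_add sum.distrib)

lemma total_degree_single [simp]: "total_degree (Poly_Mapping.single v c) = c"
  by (simp add: total_degree_def lookup_single when_def)

lemma total_degree_eq_0_iff: "total_degree t = 0 \<longleftrightarrow> t = 0"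
  by (auto simp: total_degree_def poly_mapping_eq_iff fun_eq_iff)

section \<open>Coordinates of vectors\<close>

lemma (in module) span_finite_image:
  assumes "finite J"
  shows "x \<in> span (f ` J) \<longleftrightarrow> (\<exists>c. x = (\<Sum>j\<in>J. c j *s f j))"
  using assms
proof (induction J arbitrary: x rule: finite_induct)
  case (insert i J)
  have "x \<in> span (f ` insert i J) \<longleftrightarrow> (\<exists>k c. x = k *s f i + (\<Sum>j\<in>J. c j *s f j))"
    by (simp add: span_insert insert.IH algebra_simps)
  also have "\<dots> \<longleftrightarrow> (\<exists>c. x = (\<Sum>j\<in>insert i J. c j *s f j))"
  proof
    assume "\<exists>k c. x = k *s f i + (\<Sum>j\<in>J. c j *s f j)"
    then obtain k c where "x = k *s f i + (\<Sum>j\<in>J. c j *s f j)" by blast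
    moreover have "(\<Sum>j\<in>J. (c(i := k)) j *s f j) = (\<Sum>j\<in>J. c j *s f j)"
      using insert.hyps by (intro sum.cong) auto
    ultimately show "\<exists>c. x = (\<Sum>j\<in>insert i J. c j *s f j)"
      using insert.hyps by (intro exI[of _ "c(i := k)"]) simp
  qed (use insert.hyps in auto)
  finally show ?case .
qed simp

lemma set_take_eq_image: "i \<le> length xs \<Longrightarrow> set (take i xs) = (!) xs ` {..<i}"
  by (simp add: nth_image lessThan_atLeast0)

lemma set_eq_image: "set xs = (!) xs ` {..<length xs}"
  using set_take_eq_image[of "length xs" xs] by simp

lemma set_remove_nth:
  assumes "i < length xs"
  shows "set (take i xs @ drop (Suc i) xs) = (!) xs ` ({..<length xs} - {i})"
proof -
  have "drop (Suc i) (map ((!) xs) [0..<length xs]) = map ((!) xs) [Suc i..<length xs]"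
    by (simp add: drop_map)
  then have "set (drop (Suc i) xs) = (!) xs ` {Suc i..<length xs}"
    by (simp only: map_nth set_map set_upt)
  moreover have "{..<length xs} - {i} = {..<i} \<union> {Suc i..<length xs}"
    using assms by auto
  ultimately show ?thesis
    using assms by (simp add: set_take_eq_image image_Un)
qed

lemma vscale_apply: "vscale c f j = c * f j"
  by (simp add: vscale_def)

lemma sum_vscale_apply: "(\<Sum>j\<in>J. vscale (c j) (m j)) i = (\<Sum>j\<in>J. c j * m j i)"
  by (induction J rule: infinite_finite_induct) (auto simp: vscale_def)

text \<open>
  Everything in sight is graded, so the coefficients of a homogeneous combination of homogeneous
  vectors may be replaced by their components of the expected degree.
\<close>

lemma homogeneous_coefficients:
  fixes h :: "nat \<Rightarrow> ('n::finite, 'k::comm_ring_1) polyring"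
  assumes h: "homogeneous_vec a e h" "h = (\<Sum>j\<in>J. vscale (c j) (m j))"
    and m: "\<And>j. j \<in> J \<Longrightarrow> homogeneous_vec a (b j) (m j)"
  shows "h = (\<Sum>j\<in>J. vscale (restrict_keys (\<lambda>t. total_degree t + b j = e) (c j)) (m j))"
proof
  fix i
  show "h i = (\<Sum>j\<in>J. vscale (restrict_keys (\<lambda>t. total_degree t + b j = e) (c j)) (m j)) i"
  proof (cases "i < length a")
    case True
    have "h i = restrict_keys (\<lambda>t. total_degree t + a ! i = e) (h i)"
      using h(1) True by (intro restrict_keys_id[symmetric]) (auto simp: homogeneous_vec_def)
    also have "\<dots> = (\<Sum>j\<in>J. restrict_keys (\<lambda>t. total_degree t + a ! i = e) (c j * m j i))"
      by (simp add: h(2) sum_vscale_apply restrict_keys_sum)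
    also have "\<dots> = (\<Sum>j\<in>J. restrict_keys (\<lambda>t. total_degree t + b j = e) (c j) * m j i)"
    proof (rule sum.cong[OF refl])
      fix j assume "j \<in> J"
      then have "\<forall>t\<in>Poly_Mapping.keys (m j i). total_degree t + a ! i = b j"
        using m True by (auto simp: homogeneous_vec_def)
      then have "restrict_keys (\<lambda>t. total_degree t + a ! i = e) (c j * m j i) =
          restrict_keys (\<lambda>t. total_degree t + b j = e) (c j) * restrict_keys (\<lambda>_. True) (m j i)"
        by (intro restrict_keys_times) (auto simp: add.assoc)
      then show "restrict_keys (\<lambda>t. total_degree t + a ! i = e) (c j * m j i) =
          restrict_keys (\<lambda>t. total_degree t + b j = e) (c j) * m j i"
        by (simp add: restrict_keys_id)
    qed
    finally show ?thesis by (simp add: sum_vscale_apply)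
  next
    case False
    then show ?thesis
      using h(1) m by (auto simp: homogeneous_vec_def sum_vscale_apply intro!: sum.neutral[symmetric])
  qed
qed

section \<open>Linear quotients give linear resolutions\<close>

text \<open>
  Linear quotients for vectors of one degree \<open>e\<close> in the graded free module with degrees \<open>a\<close>. The
  index \<open>i = 0\<close> is included: there the condition says that the annihilator of the first vector is
  generated by variables.
\<close>

definition linear_quotient_list ::
  "nat list \<Rightarrow> nat \<Rightarrow> (nat \<Rightarrow> ('n::finite, 'k::comm_ring_1) polyring) list \<Rightarrow> bool" where
  "linear_quotient_list a e ms \<longleftrightarrow>
     (\<forall>m\<in>set ms. homogeneous_vec a e m) \<and>
     (\<forall>i<length ms. \<exists>V. \<forall>h. vscale h (ms ! i) \<in> free.span (set (take i ms)) \<longleftrightarrow>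
        h \<in> ideal.span (var ` V))"

text \<open>
  A vector that is a combination of others of its own degree is one with constant coefficients. The
  last nonzero coefficient of the resulting relation then lies in a colon ideal; but an ideal
  generated by variables contains no nonzero constant.
\<close>

lemma linear_quotient_list_irredundant:
  fixes ms :: "(nat \<Rightarrow> ('n::finite, 'k::comm_ring_1) polyring) list"
  assumes ms: "linear_quotient_list a e ms" and i: "i < length ms"
  shows "ms ! i \<notin> free.span (set (take i ms @ drop (Suc i) ms))"
proof
  let ?n = "length ms"
  assume "ms ! i \<in> free.span (set (take i ms @ drop (Suc i) ms))"
  then obtain c where c: "ms ! i = (\<Sum>j\<in>{..<?n} - {i}. vscale (c j) (ms ! j))"
    unfolding set_remove_nth[OF i] by (auto simp: free.span_finite_image)
  define d where "d j = (if j = i then -1 else restrict_keys (\<lambda>t. total_degree t + e = e) (c j))" for j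
  have hom: "homogeneous_vec a e (ms ! j)" if "j < ?n" for j
    using ms that by (auto simp: linear_quotient_list_def)
  have "ms ! i = (\<Sum>j\<in>{..<?n} - {i}.
      vscale (restrict_keys (\<lambda>t. total_degree t + e = e) (c j)) (ms ! j))"
    by (rule homogeneous_coefficients[OF hom[OF i] c, of "\<lambda>_. e"]) (use hom in auto)
  then have "ms ! i = (\<Sum>j\<in>{..<?n} - {i}. vscale (d j) (ms ! j))"
    by (simp add: d_def)
  moreover have "(\<Sum>j<?n. vscale (d j) (ms ! j)) =
      vscale (d i) (ms ! i) + (\<Sum>j\<in>{..<?n} - {i}. vscale (d j) (ms ! j))"
    using i by (simp add: sum.remove)
  ultimately have d0: "(\<Sum>j<?n. vscale (d j) (ms ! j)) = 0"
    by (simp add: d_def)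
  have keys_d: "Poly_Mapping.keys (d j) \<subseteq> {0}" for j
    by (auto simp: d_def keys_restrict_keys total_degree_eq_0_iff in_keys_iff lookup_one when_def)
  \<comment> \<open>the last term of the relation \<open>d0\<close> with nonzero coefficient\<close>
  define l where "l = Max {j. j < ?n \<and> d j \<noteq> 0}"
  have "i \<in> {j. j < ?n \<and> d j \<noteq> 0}" using i by (simp add: d_def)
  then have "l \<in> {j. j < ?n \<and> d j \<noteq> 0}" unfolding l_def by (intro Max_in) auto
  then have l: "l < ?n" "d l \<noteq> 0" by auto
  have l_max: "d j = 0" if "j < ?n" "l < j" for j
  proof (rule ccontr)
    assume "d j \<noteq> 0"
    with that(1) have "j \<le> l" unfolding l_def by (intro Max_ge) auto
    with that(2) show False by simp
  qed
  have "(\<Sum>j<?n. vscale (d j) (ms ! j)) = (\<Sum>j<Suc l. vscale (d j) (ms ! j))"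
    using l l_max by (intro sum.mono_neutral_right) auto
  with d0 have "vscale (d l) (ms ! l) = - (\<Sum>j<l. vscale (d j) (ms ! j))"
    by (simp add: eq_neg_iff_add_eq_0 add.commute)
  moreover have "(\<Sum>j<l. vscale (d j) (ms ! j)) \<in> free.span (set (take l ms))"
    using l by (auto simp: set_take_eq_image free.span_finite_image)
  ultimately have "vscale (d l) (ms ! l) \<in> free.span (set (take l ms))"
    by (simp add: free.span_neg)
  then obtain V where "d l \<in> ideal.span (var ` V)"
    using ms l by (auto simp: linear_quotient_list_def)
  then have "Poly_Mapping.keys (d l) = {}"
    using keys_d[of l] by (fastforce simp: mem_span_var_iff)
  with l show False by (simp add: keys_empty_iff)
qed

lemma subspace_relation_module: "free.subspace (relation_module gs)"
proof (rule free.subspaceI)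
  fix x y assume "x \<in> relation_module gs" "y \<in> relation_module gs"
  then show "x + y \<in> relation_module gs"
    by (simp add: relation_module_def free.scale_left_distrib sum.distrib)
next
  fix c x assume "x \<in> relation_module gs"
  moreover have "(\<Sum>i<length gs. vscale (vscale c x i) (gs ! i)) =
      vscale c (\<Sum>i<length gs. vscale (x i) (gs ! i))"
    by (rule ext) (simp add: sum_vscale_apply vscale_apply sum_distrib_left mult.assoc)
  ultimately show "vscale c x \<in> relation_module gs"
    by (simp add: relation_module_def) (simp add: vscale_apply)
qed (simp add: relation_module_def)

text \<open>
  The last nonzero coefficient of a relation, say at \<open>i\<close>, lies in the \<open>i\<close>-th colon ideal. So the
  relation module is generated by relations \<open>R (i, x)\<close> with last coefficient \<open>x\<close> at \<open>i\<close>, for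
  each variable \<open>x\<close> among the generators \<open>V i\<close> of that ideal. List them by increasing \<open>i\<close>.
  If \<open>h\<close> times \<open>R (i, x)\<close> is a combination of earlier ones, comparing the coefficients at \<open>i\<close>
  shows that \<open>h * x\<close> is in the ideal generated by those \<open>y \<noteq> x\<close> for which \<open>R (i, y)\<close> precedes
  \<open>R (i, x)\<close>; hence so is \<open>h\<close>. Conversely these \<open>y\<close> belong to the colon ideal because of the
  Koszul relations between \<open>x\<close> and \<open>y\<close>.
\<close>

lemma linear_quotient_list_syzygies:
  fixes ms :: "(nat \<Rightarrow> ('n::finite, 'k::comm_ring_1) polyring) list"
  assumes ms: "linear_quotient_list a e ms"
  shows "\<exists>ms'. linear_quotient_list (replicate (length ms) e) (Suc e) ms' \<and>
    free.span (set ms') = relation_module ms"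
proof -
  let ?n = "length ms"
  let ?rel = "relation_module ms"
  have "\<forall>i\<in>{..<?n}. \<exists>V. \<forall>h. vscale h (ms ! i) \<in> free.span (set (take i ms)) \<longleftrightarrow> h \<in> ideal.span (var ` V)"
    using ms by (simp add: linear_quotient_list_def)
  from bchoice[OF this] obtain V where "\<forall>i\<in>{..<?n}. \<forall>h.
      vscale h (ms ! i) \<in> free.span (set (take i ms)) \<longleftrightarrow> h \<in> ideal.span (var ` V i)"
    by blast
  then have V: "vscale h (ms ! i) \<in> free.span (set (take i ms)) \<longleftrightarrow> h \<in> ideal.span (var ` V i)"
    if "i < ?n" for i h using that by blast
  have hom: "homogeneous_vec a e (ms ! j)" if "j < ?n" for j
    using ms that by (auto simp: linear_quotient_list_def)
  have split_sum: "(\<Sum>j<?n. vscale (f j) (ms ! j)) = (\<Sum>j<i. vscale (f j) (ms ! j)) + vscale (f i) (ms ! i)"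
    if "i < ?n" "\<forall>j>i. f j = 0" for i f
  proof -
    have "(\<Sum>j<?n. vscale (f j) (ms ! j)) = (\<Sum>j<Suc i. vscale (f j) (ms ! j))"
      using that by (intro sum.mono_neutral_right) auto
    then show ?thesis by simp
  qed
  have "\<exists>f. f \<in> ?rel \<and> f i = var x \<and> (\<forall>j>i. f j = 0) \<and> homogeneous_vec (replicate ?n e) (Suc e) f"
    if i: "i < ?n" and x: "x \<in> V i" for i x
  proof -
    have "vscale (var x) (ms ! i) \<in> free.span (set (take i ms))"
      using V[OF i] x by (simp add: ideal.span_base)
    then obtain c where c: "vscale (var x) (ms ! i) = (\<Sum>j<i. vscale (c j) (ms ! j))"
      using i by (auto simp: set_take_eq_image free.span_finite_image)
    define d where "d j = restrict_keys (\<lambda>t. total_degree t + e = Suc e) (c j)" for j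
    have "homogeneous_vec a (Suc e) (vscale (var x) (ms ! i))"
      using hom[OF i] by (auto simp: homogeneous_vec_def vscale_def var_def elim!: keys_times_subset)
    then have d: "vscale (var x) (ms ! i) = (\<Sum>j<i. vscale (d j) (ms ! j))"
      unfolding d_def using i hom by (intro homogeneous_coefficients[OF _ c]) auto
    define f where "f j = (if j < i then - d j else if j = i then var x else 0)" for j
    have "(\<Sum>j<?n. vscale (f j) (ms ! j)) = 0"
      using i by (subst split_sum[of i]) (auto simp: f_def d sum_negf)
    then have "f \<in> ?rel" using i by (auto simp: relation_module_def f_def)
    moreover have "homogeneous_vec (replicate ?n e) (Suc e) f"
      using i by (auto simp: homogeneous_vec_def f_def d_def var_def in_keys_iff lookup_restrict_keys)
    ultimately show ?thesis
      by (intro exI[of _ f]) (auto simp: f_def)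
  qed
  then have "\<forall>p\<in>Sigma {..<?n} V. \<exists>f. f \<in> ?rel \<and> f (fst p) = var (snd p) \<and> (\<forall>j>fst p. f j = 0) \<and>
      homogeneous_vec (replicate ?n e) (Suc e) f" by auto
  from bchoice[OF this] obtain R where choice: "\<forall>p\<in>Sigma {..<?n} V. R p \<in> ?rel \<and> R p (fst p) = var (snd p) \<and>
      (\<forall>j>fst p. R p j = 0) \<and> homogeneous_vec (replicate ?n e) (Suc e) (R p)"
    by blast
  have R: "R (i, x) \<in> ?rel \<and> R (i, x) i = var x \<and> (\<forall>j>i. R (i, x) j = 0) \<and>
      homogeneous_vec (replicate ?n e) (Suc e) (R (i, x))" if "i < ?n" "x \<in> V i" for i x
    using bspec[OF choice, of "(i, x)"] that by simp
  \<comment> \<open>subtracting a combination of the \<open>R (i, x)\<close> clears the last nonzero coordinate \<open>i\<close> of a relation\<close>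
  have span_R: "f \<in> free.span (R ` Sigma {..<i} V)"
    if "f \<in> ?rel" "\<forall>j\<ge>i. f j = 0" "i \<le> ?n" for f i
    using that
  proof (induction i arbitrary: f)
    case 0
    then have "f = 0" by (simp add: fun_eq_iff)
    show ?case unfolding \<open>f = 0\<close> by (rule free.span_zero)
  next
    case (Suc i)
    from Suc.prems(3) have i: "i < ?n" by simp
    have "(\<Sum>j<i. vscale (f j) (ms ! j)) + vscale (f i) (ms ! i) = 0"
      using Suc.prems i by (subst split_sum[symmetric]) (auto simp: relation_module_def)
    then have "vscale (f i) (ms ! i) = - (\<Sum>j<i. vscale (f j) (ms ! j))"
      by (simp add: eq_neg_iff_add_eq_0 add.commute)
    also have "\<dots> \<in> free.span (set (take i ms))"
      using i by (intro free.span_neg) (auto simp: set_take_eq_image free.span_finite_image)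
    finally have "f i \<in> ideal.span (var ` V i)" using V[OF i] by blast
    then obtain c where c: "f i = (\<Sum>x\<in>V i. c x * var x)"
      by (auto simp: ideal.span_finite_image)
    define g where "g = (\<Sum>x\<in>V i. vscale (c x) (R (i, x)))"
    have "g \<in> ?rel" unfolding g_def
      using R i subspace_relation_module by (intro free.subspace_sum free.subspace_scale) auto
    then have fg: "f - g \<in> ?rel"
      using Suc.prems(1) subspace_relation_module by (intro free.subspace_diff) auto
    have fg0: "(f - g) j = 0" if "j \<ge> i" for j
    proof (cases "j = i")
      case True
      then show ?thesis using R i by (simp add: g_def sum_vscale_apply c)
    next
      case False
      then show ?thesis using R i that Suc.prems by (simp add: g_def sum_vscale_apply)
    qed
    have "f - g \<in> free.span (R ` Sigma {..<i} V)"
      using Suc.IH[OF fg] fg0 i by (meson less_imp_le)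
    then have "f - g \<in> free.span (R ` Sigma {..<Suc i} V)"
      by (rule subsetD[OF free.span_mono, rotated]) auto
    moreover have "g \<in> free.span (R ` Sigma {..<Suc i} V)"
      unfolding g_def by (intro free.span_sum free.span_scale free.span_base) auto
    ultimately have "f - g + g \<in> free.span (R ` Sigma {..<Suc i} V)" by (rule free.span_add)
    then show ?case by (simp only: diff_add_cancel)
  qed
  obtain qs where "set qs = Sigma {..<?n} V" "distinct qs"
    using finite_distinct_list[of "Sigma {..<?n} V"] by auto
  then obtain ps where ps: "set ps = Sigma {..<?n} V" "distinct ps" "sorted (map fst ps)"
    by (metis distinct_sort set_sort sorted_sort_key)
  define ms' where "ms' = map R ps"
  have "free.span (set ms') = ?rel"
  proof
    show "free.span (set ms') \<subseteq> ?rel"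
      using R subspace_relation_module by (intro free.span_minimal) (auto simp: ms'_def ps)
    show "?rel \<subseteq> free.span (set ms')"
      using span_R[of _ ?n] by (auto simp: ms'_def ps relation_module_def)
  qed
  moreover have "linear_quotient_list (replicate ?n e) (Suc e) ms'"
    unfolding linear_quotient_list_def
  proof (intro conjI allI impI)
    show "\<forall>m\<in>set ms'. homogeneous_vec (replicate ?n e) (Suc e) m"
      using R by (auto simp: ms'_def ps)
    fix p assume "p < length ms'"
    then have p: "p < length ps" by (simp add: ms'_def)
    obtain i x where ix: "ps ! p = (i, x)" by fastforce
    have "(i, x) \<in> set ps" using p ix by (metis nth_mem)
    then have i: "i < ?n" and x: "x \<in> V i" by (auto simp: ps)
    define W where "W = {y. (i, y) \<in> set (take p ps)}"
    have in_take: "r \<in> set (take p ps) \<longleftrightarrow> (\<exists>q<p. r = ps ! q)" for r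
      using p by (auto simp: set_take_eq_image)
    have "x \<notin> W"
      using p ps(2) by (auto simp: W_def in_take nth_eq_iff_index_eq simp flip: ix)
    have W: "y \<in> V i" if "y \<in> W" for y
      using that set_take_subset[of p ps] ps(1) by (auto simp: W_def)
    have take_p: "set (take p ps) = Sigma {..<i} V \<union> {i} \<times> W"
    proof (intro equalityI subsetI)
      fix r assume r: "r \<in> set (take p ps)"
      then obtain q where "q < p" "r = ps ! q" by (auto simp: in_take)
      then have "fst r \<le> i"
        using sorted_nth_mono[OF ps(3), of q p] p by (simp add: ix)
      moreover have "r \<in> Sigma {..<?n} V" using r set_take_subset[of p ps] ps(1) by auto
      ultimately show "r \<in> Sigma {..<i} V \<union> {i} \<times> W"
        using r by (cases r) (auto simp: W_def)
    next
      fix r assume r: "r \<in> Sigma {..<i} V \<union> {i} \<times> W"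
      show "r \<in> set (take p ps)"
      proof (cases "r \<in> {i} \<times> W")
        case False
        with r have r': "r \<in> Sigma {..<i} V" by blast
        with i have "r \<in> set ps" by (auto simp: ps)
        then obtain q where q: "q < length ps" "r = ps ! q" by (auto simp: in_set_conv_nth)
        have "q < p"
        proof (rule ccontr)
          assume "\<not> q < p"
          then have "i \<le> fst r"
            using sorted_nth_mono[OF ps(3), of p q] q by (simp add: ix)
          with r' show False by auto
        qed
        with q show ?thesis by (auto simp: in_take)
      qed (auto simp: W_def)
    qed
    have ev: "f i \<in> ideal.span (var ` W)" if "f \<in> free.span (R ` set (take p ps))" for f
      using that
    proof (induction rule: free.span_induct_alt)
      case (step c f g)
      have "f i \<in> ideal.span (var ` W)"
        using step.hyps R i W unfolding take_p
        by (auto intro: ideal.span_base simp: ideal.span_zero)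
      then show ?case using step.IH by (simp add: vscale_apply ideal.span_add ideal.span_scale)
    qed (simp add: ideal.span_zero)
    have "vscale h (R (i, x)) \<in> free.span (R ` set (take p ps))" if "h \<in> ideal.span (var ` W)" for h
      using that
    proof (induction rule: ideal.span_induct_alt)
      case (step c v h)
      then obtain y where y: "v = var y" "y \<in> W" by blast
      \<comment> \<open>the Koszul relation between \<open>R (i, x)\<close> and \<open>R (i, y)\<close> involves earlier relations only\<close>
      have koszul: "vscale (var y) (R (i, x)) - vscale (var x) (R (i, y)) \<in> ?rel"
        using R i x W[OF y(2)] subspace_relation_module
        by (intro free.subspace_diff free.subspace_scale) auto
      have "(vscale (var y) (R (i, x)) - vscale (var x) (R (i, y))) j = 0" if "i \<le> j" for j
        using R[OF i x] R[OF i W[OF y(2)]] that by (cases "j = i") (auto simp: vscale_apply)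
      then have "vscale (var y) (R (i, x)) - vscale (var x) (R (i, y)) \<in> free.span (R ` Sigma {..<i} V)"
        using span_R[OF koszul] i by (meson less_imp_le)
      then have "vscale (var y) (R (i, x)) - vscale (var x) (R (i, y)) \<in> free.span (R ` set (take p ps))"
        by (rule subsetD[OF free.span_mono, rotated]) (auto simp: take_p)
      moreover have "vscale (var x) (R (i, y)) \<in> free.span (R ` set (take p ps))"
        using y by (intro free.span_scale free.span_base) (auto simp: take_p)
      ultimately have "vscale (var y) (R (i, x)) - vscale (var x) (R (i, y)) + vscale (var x) (R (i, y))
          \<in> free.span (R ` set (take p ps))" by (rule free.span_add)
      then have "vscale (var y) (R (i, x)) \<in> free.span (R ` set (take p ps))"
        by (simp only: diff_add_cancel)
      then have "vscale c (vscale (var y) (R (i, x))) + vscale h (R (i, x)) \<in> free.span (R ` set (take p ps))"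
        using step.IH by (rule free.span_add[OF free.span_scale])
      then show ?case by (simp only: y free.scale_left_distrib free.scale_scale)
    qed (simp only: free.scale_zero_left free.span_zero)
    moreover have "h \<in> ideal.span (var ` W)" if "vscale h (R (i, x)) \<in> free.span (R ` set (take p ps))" for h
      using ev[OF that] R[OF i x] var_times_mem_span_var[OF _ \<open>x \<notin> W\<close>] by (simp add: vscale_apply)
    ultimately show "\<exists>V. \<forall>h. vscale h (ms' ! p) \<in> free.span (set (take p ms')) \<longleftrightarrow>
        h \<in> ideal.span (var ` V)"
      using p by (intro exI[of _ W]) (auto simp: ms'_def ix take_map)
  qed
  ultimately show ?thesis by blast
qed

lemma linear_quotient_list_minimal_generators:
  fixes ms :: "(nat \<Rightarrow> ('n::finite, 'k::comm_ring_1) polyring) list"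
  assumes "linear_quotient_list a e ms" "free.span (set ms) = M"
  shows "minimal_homogeneous_generators a M ms (replicate (length ms) e)"
  unfolding minimal_homogeneous_generators_def
proof (intro conjI allI impI)
  fix i assume i: "i < length ms"
  then show "homogeneous_vec a (replicate (length ms) e ! i) (ms ! i)"
    using assms(1) by (simp add: linear_quotient_list_def)
  show "ms ! i \<notin> free.span (set (take i ms @ drop (Suc i) ms))"
    using assms(1) i by (rule linear_quotient_list_irredundant)
qed (use assms(2) in simp_all)

lemma linear_quotient_list_generated:
  fixes ms :: "(nat \<Rightarrow> ('n::finite, 'k::comm_ring_1) polyring) list"
  assumes ms: "linear_quotient_list a e ms" and M: "free.span (set ms) = M" "M \<noteq> {0}"
  shows "generated_in_degree a M e"
proof -
  have "set ms \<subseteq> {f \<in> M. homogeneous_vec a e f}"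
    using ms M free.span_superset[of "set ms"] by (auto simp: linear_quotient_list_def)
  then have "M \<subseteq> free.span {f \<in> M. homogeneous_vec a e f}"
    using M(1) free.span_mono by blast
  moreover have "free.subspace M" using M(1) by auto
  then have "free.span {f \<in> M. homogeneous_vec a e f} \<subseteq> M"
    by (intro free.span_minimal) auto
  ultimately show ?thesis using M by (auto simp: generated_in_degree_def)
qed

text \<open>
  The ring as a free module of rank one, that is, as the functions that vanish outside \<open>0\<close>.
\<close>

definition vec_of :: "'a::zero \<Rightarrow> nat \<Rightarrow> 'a" where
  "vec_of u = (\<lambda>j. if j = 0 then u else 0)"

lemma vec_of_0 [simp]: "vec_of u 0 = u"
  by (simp add: vec_of_def)

lemma vec_of_eq_iff [simp]: "vec_of u = vec_of w \<longleftrightarrow> u = w"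
proof
  assume "vec_of u = vec_of w"
  then have "vec_of u 0 = vec_of w 0" by simp
  then show "u = w" by simp
qed simp

lemma vscale_vec_of: "vscale c (vec_of u) = vec_of (c * u)"
  by (rule ext) (simp add: vscale_apply vec_of_def)

lemma vec_of_zero: "vec_of 0 = 0"
  by (rule ext) (simp add: vec_of_def)

lemma span_vec_of: "free.span (vec_of ` B) = vec_of ` ideal.span (B :: 'a::comm_ring_1 set)"
proof -
  have "module_hom ((*) :: 'a \<Rightarrow> 'a \<Rightarrow> 'a) vscale vec_of"
    by unfold_locales (rule ext, simp add: vec_of_def vscale_apply distrib_left)+
  then show ?thesis by (rule module_hom.span_image)
qed

lemma syzygy_module_0_eq: "syzygy_module I g 0 = vec_of ` I"
proof (intro equalityI subsetI)
  fix f assume "f \<in> syzygy_module I g 0"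
  then have "f = vec_of (f 0)" "f 0 \<in> I" by (auto simp: vec_of_def)
  then show "f \<in> vec_of ` I" by blast
qed (auto simp: vec_of_def)

lemma linear_quotient_list_imp_linear_resolution:
  fixes ms :: "(nat \<Rightarrow> ('n::finite, 'k::comm_ring_1) polyring) list"
  assumes ms: "linear_quotient_list [0] d ms" "free.span (set ms) = vec_of ` I" and x: "x \<in> I" "x \<noteq> 0"
  shows "has_linear_resolution I"
proof -
  let ?P = "\<lambda>n p. linear_quotient_list (fst p) (d + n) (snd p) \<and> (n = 0 \<longrightarrow> p = ([0], ms))"
  let ?Q = "\<lambda>n p q. fst q = replicate (length (snd p)) (d + n) \<and>
      free.span (set (snd q)) = relation_module (snd p)"
  have "\<exists>F. \<forall>n. ?P n (F n) \<and> ?Q n (F n) (F (Suc n))"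
  proof (rule dependent_nat_choice)
    show "\<exists>x. ?P 0 x" using ms(1) by (intro exI[of _ "([0], ms)"]) simp
    fix x n assume x: "?P n x"
    let ?a = "replicate (length (snd x)) (d + n)"
    from x have "linear_quotient_list (fst x) (d + n) (snd x)" by blast
    from linear_quotient_list_syzygies[OF this] obtain ms' where
      "linear_quotient_list ?a (Suc (d + n)) ms'" "free.span (set ms') = relation_module (snd x)"
      by blast
    then show "\<exists>y. ?P (Suc n) y \<and> ?Q n x y"
      by (intro exI[of _ "(?a, ms')"]) simp
  qed
  then obtain F where "\<forall>n. ?P n (F n) \<and> ?Q n (F n) (F (Suc n))" by blast
  then have F: "?P n (F n)" "?Q n (F n) (F (Suc n))" for n by blast+
  define a where "a n = fst (F n)" for n
  define g where "g n = snd (F n)" for n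
  have lq: "linear_quotient_list (a n) (d + n) (g n)" for n
    using F(1)[of n] by (simp add: a_def g_def)
  have start: "a 0 = [0]" "g 0 = ms"
    using F(1)[of 0] by (simp_all add: a_def g_def)
  have a_Suc: "a (Suc n) = replicate (length (g n)) (d + n)" for n
    using F(2)[of n] by (simp add: a_def g_def)
  have span_g: "free.span (set (g n)) = syzygy_module I g n" for n
  proof (cases n)
    case 0
    then show ?thesis using ms(2) start syzygy_module_0_eq[of I g] by simp
  next
    case (Suc k)
    then show ?thesis using F(2)[of k] by (simp add: g_def)
  qed
  have res: "minimal_graded_free_resolution I a g"
    unfolding minimal_graded_free_resolution_def a_Suc
    by (intro conjI allI start linear_quotient_list_minimal_generators[OF lq span_g])
  have gen: "syzygy_module I g n = {0} \<or> generated_in_degree (a n) (syzygy_module I g n) (d + n)" for n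
    using linear_quotient_list_generated[OF lq span_g] by blast
  have "vec_of x \<in> syzygy_module I g 0" using x(1) unfolding syzygy_module_0_eq by blast
  moreover have "vec_of x \<noteq> 0" using x(2) vec_of_eq_iff[of x 0] unfolding vec_of_zero by blast
  ultimately have "generated_in_degree (a 0) (syzygy_module I g 0) (d + 0)"
    using gen[of 0] by blast
  then show ?thesis
    unfolding has_linear_resolution_def using res gen by (metis add_0_right)
qed

text \<open>
  The minimal generator \<open>u\<close> is divisible by the monomial of some \<open>s \<in> A\<close>, which in turn is
  divisible by a minimal generator. By irredundance the latter is \<open>u\<close>, so all three agree.
\<close>

lemma minimal_monomial_generators_subset:
  fixes A :: "('n::finite \<Rightarrow>\<^sub>0 nat) set" and B :: "('n, 'k::comm_ring_1) polyring set"
  assumes B: "minimal_monomial_generators (ideal.span (mon ` A)) B" and u: "u \<in> B"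
  obtains t where "t \<in> A" "u = mon t"
proof -
  define T where "T = {t. mon t \<in> B}"
  have BT: "B = mon ` T"
    using B by (auto simp: minimal_monomial_generators_def monomials_def T_def)
  then obtain t where t: "u = mon t" "t \<in> T" using u by blast
  have span_eq: "ideal.span (mon ` T) = (ideal.span (mon ` A) :: ('n, 'k) polyring set)"
    using B by (auto simp: minimal_monomial_generators_def BT)
  have "(mon t :: ('n, 'k) polyring) \<in> ideal.span (mon ` A)"
    using span_eq t by (metis ideal.span_base image_eqI)
  then obtain s r where s: "s \<in> A" "t = s + r" by (auto simp: mon_mem_monomial_ideal_iff)
  have "(mon s :: ('n, 'k) polyring) \<in> ideal.span (mon ` T)"
    using span_eq s by (metis ideal.span_base image_eqI)
  then obtain t' r' where t': "t' \<in> T" "s = t' + r'" by (auto simp: mon_mem_monomial_ideal_iff)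
  have "t' = t"
  proof (rule ccontr)
    assume "t' \<noteq> t"
    then have "mon ` {t'} \<subseteq> B - {u}" using t t' BT by (auto simp: mon_eq_iff)
    moreover have "u \<in> ideal.span (mon ` {t'})"
      unfolding t(1) using s t' by (intro mon_in_span[of t' _ _ "r' + r"]) (auto simp: add.assoc)
    ultimately have "u \<in> ideal.span (B - {u})" using ideal.span_mono by blast
    with B u show False by (auto simp: minimal_monomial_generators_def)
  qed
  with s t' have "total_degree t = total_degree t + total_degree r' + total_degree r"
    by (metis total_degree_add)
  then have "t = s" using s by (simp add: total_degree_eq_0_iff)
  then show thesis using that[of t] s(1) t(1) by simp
qed

theorem linear_quotients_imp_linear_resolution:
  fixes A :: "('n::finite \<Rightarrow>\<^sub>0 nat) set" and I :: "('n, 'k::comm_ring_1) polyring set"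
  assumes I: "I = ideal.span (mon ` A)" and deg: "\<And>t. t \<in> A \<Longrightarrow> total_degree t = d"
    and lq: "has_linear_quotients I"
  shows "has_linear_resolution I"
proof -
  from lq obtain us where us: "us \<noteq> []" "minimal_monomial_generators I (set us)"
    and colon: "\<And>i. 1 \<le> i \<Longrightarrow> i < length us \<Longrightarrow> \<exists>V. ideal_colon (ideal.span (set (take i us)))
        (ideal.span {us ! i}) = ideal.span (var ` V)"
    unfolding has_linear_quotients_def by blast
  have mon_us: "\<exists>t\<in>A. u = mon t" if "u \<in> set us" for u
    using minimal_monomial_generators_subset[of A "set us" u] us(2) that I by blast
  have span_us: "ideal.span (set us) = I" using us by (simp add: minimal_monomial_generators_def)
  have "linear_quotient_list [0] d (map vec_of us)"
    unfolding linear_quotient_list_def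
  proof (intro conjI allI impI)
    show "\<forall>m\<in>set (map vec_of us). homogeneous_vec [0] d m"
      using mon_us deg by (fastforce simp: homogeneous_vec_def vec_of_def)
    fix i assume "i < length (map vec_of us)"
    then have i: "i < length us" by simp
    have mem: "vscale h (map vec_of us ! i) \<in> free.span (set (take i (map vec_of us))) \<longleftrightarrow>
        h * us ! i \<in> ideal.span (set (take i us))" for h
      using i by (auto simp: take_map span_vec_of vscale_vec_of)
    show "\<exists>V. \<forall>h. vscale h (map vec_of us ! i) \<in> free.span (set (take i (map vec_of us))) \<longleftrightarrow>
        h \<in> ideal.span (var ` V)"
    proof (cases "i = 0")
      case True
      \<comment> \<open>a monomial is not a zero divisor, so the empty set of variables works\<close>
      obtain t where "us ! i = mon t" using mon_us i by (metis nth_mem)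
      then have "h * us ! i \<in> ideal.span (set (take i us)) \<longleftrightarrow> h \<in> ideal.span (var ` {})" for h
        using True by (simp add: times_mon_eq_0_iff)
      then show ?thesis unfolding mem by blast
    next
      case False
      then obtain V where V: "ideal_colon (ideal.span (set (take i us)))
        (ideal.span {us ! i}) = ideal.span (var ` V)" using colon[of i] i by auto
      have "h * us ! i \<in> ideal.span (set (take i us)) \<longleftrightarrow> h \<in> ideal.span (var ` V)" for h
        unfolding V[symmetric] ideal_colon_def ideal.span_singleton
        by (auto simp: mult.left_commute[of h] intro: ideal.span_scale dest: spec[of _ 1])
      then show ?thesis unfolding mem by blast
    qed
  qed
  moreover have "free.span (set (map vec_of us)) = vec_of ` I"
    by (simp add: span_vec_of span_us)
  moreover obtain t where "us ! 0 = mon t" using mon_us us(1) by (metis length_greater_0_conv nth_mem)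
  then have "mon t \<in> I" using span_us us(1) by (metis ideal.span_base length_greater_0_conv nth_mem)
  moreover have "(mon t :: ('n, 'k) polyring) \<noteq> 0"
    by (metis lookup_single_eq lookup_zero zero_neq_one)
  ultimately show ?thesis by (rule linear_quotient_list_imp_linear_resolution)
qed

section \<open>A criterion for linear quotients\<close>

text \<open>
  Sort the exponents by \<open>key\<close>. If a monomial \<open>s\<close> times the monomial of \<open>t\<close> is divisible by that
  of an earlier \<open>t'\<close>, then the coordinate \<open>v\<close> supplied by the exchange condition must occur in
  \<open>s\<close>, and the variable \<open>v\<close> alone already carries the monomial of \<open>t\<close> into the ideal of the
  earlier ones. So the colon ideal is generated by variables.
\<close>

lemma has_linear_quotients_by_key:
  fixes T :: "('n::finite \<Rightarrow>\<^sub>0 nat) set" and key :: "('n \<Rightarrow>\<^sub>0 nat) \<Rightarrow> nat"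
  assumes T: "finite T" "T \<noteq> {}" and deg: "\<And>t. t \<in> T \<Longrightarrow> total_degree t = d"
    and exchange: "\<And>t t'. t \<in> T \<Longrightarrow> t' \<in> T \<Longrightarrow> t' \<noteq> t \<Longrightarrow> key t' \<le> key t \<Longrightarrow>
      \<exists>v. Poly_Mapping.lookup t v < Poly_Mapping.lookup t' v \<and>
        (\<exists>t''\<in>T. key t'' < key t \<and> (\<exists>r. t + Poly_Mapping.single v 1 = t'' + r))"
  shows "has_linear_quotients (ideal.span (mon ` T) :: ('n, 'k::comm_ring_1) polyring set)"
proof -
  obtain ts where "set ts = T" "distinct ts" using finite_distinct_list[OF T(1)] by blast
  then have "set (sort_key key ts) = T" "distinct (sort_key key ts)" "sorted (map key (sort_key key ts))"
    by simp_all
  then obtain ts where ts: "set ts = T" "distinct ts" "sorted (map key ts)" by blast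
  define us :: "('n, 'k) polyring list" where "us = map mon ts"
  have inj: "inj mon" by (rule injI) (simp add: mon_eq_iff)
  have "minimal_monomial_generators (ideal.span (mon ` T)) (set us)"
    unfolding minimal_monomial_generators_def
  proof (intro conjI ballI)
    show "set us \<subseteq> monomials" by (auto simp: us_def monomials_def)
    show "ideal.span (set us) = ideal.span (mon ` T)" by (simp add: us_def ts)
    fix u assume "u \<in> set us"
    then obtain t where t: "t \<in> T" "u = mon t" by (auto simp: us_def ts)
    show "u \<notin> ideal.span (set us - {u})"
    proof
      assume "u \<in> ideal.span (set us - {u})"
      moreover have "set us - {u} = mon ` (T - {t})"
        by (auto simp: us_def ts t mon_eq_iff)
      ultimately have "(mon t :: ('n, 'k) polyring) \<in> ideal.span (mon ` (T - {t}))"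
        using t(2) by simp
      then obtain s r where s: "s \<in> T - {t}" "t = s + r"
        unfolding mon_mem_monomial_ideal_iff by blast
      have "total_degree t = d" "total_degree s = d" using deg t(1) s(1) by auto
      then have "total_degree r = 0" using s(2) by simp
      then have "r = 0" by (simp only: total_degree_eq_0_iff)
      then show False using s by simp
    qed
  qed
  moreover have "\<exists>V. ideal_colon (ideal.span (set (take i us))) (ideal.span {us ! i}) = ideal.span (var ` V)"
    if i: "i < length us" for i
  proof -
    define t where "t = ts ! i"
    define P where "P = set (take i ts)"
    have it: "i < length ts" using i by (simp add: us_def)
    have tT: "t \<in> T" using it ts by (auto simp: t_def)
    have PT: "P \<subseteq> T" using set_take_subset[of i ts] ts by (simp add: P_def)
    have P_le: "key s \<le> key t" "s \<noteq> t" if s: "s \<in> P" for s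
    proof -
      obtain j where j: "j < i" "s = ts ! j" using s it by (auto simp: P_def set_take_eq_image)
      then show "key s \<le> key t" using sorted_nth_mono[OF ts(3), of j i] it by (simp add: t_def)
      show "s \<noteq> t" using j it ts(2) by (simp add: t_def nth_eq_iff_index_eq)
    qed
    have less_P: "s \<in> P" if s: "s \<in> T" "key s < key t" for s
    proof -
      obtain j where j: "j < length ts" "s = ts ! j" using s ts by (metis in_set_conv_nth)
      have "j < i"
      proof (rule ccontr)
        assume "\<not> j < i"
        then have "key t \<le> key s" using sorted_nth_mono[OF ts(3), of i j] j by (simp add: t_def)
        with s show False by simp
      qed
      then show ?thesis using j it by (auto simp: P_def set_take_eq_image)
    qed
    define V where "V = {v. \<exists>t''\<in>P. \<exists>r. t + Poly_Mapping.single v 1 = t'' + r}"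
    have colon_iff: "h \<in> ideal_colon (ideal.span (set (take i us))) (ideal.span {us ! i}) \<longleftrightarrow>
        h * mon t \<in> ideal.span (mon ` P)" for h :: "('n, 'k) polyring"
      unfolding ideal_colon_def ideal.span_singleton using it
      by (auto simp: us_def take_map t_def P_def mult.left_commute[of h]
          intro: ideal.span_scale dest: spec[of _ 1])
    have "h * mon t \<in> ideal.span (mon ` P) \<longleftrightarrow> h \<in> ideal.span (var ` V)" for h :: "('n, 'k) polyring"
    proof
      assume h: "h * mon t \<in> ideal.span (mon ` P)"
      show "h \<in> ideal.span (var ` V)"
        unfolding mem_span_var_iff
      proof
        fix s assume "s \<in> Poly_Mapping.keys h"
        then have "s + t \<in> Poly_Mapping.keys (h * mon t)" by (rule keys_times_mon)
        with h obtain t' r where t': "t' \<in> P" "s + t = t' + r" unfolding mem_monomial_ideal_iff by blast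
        obtain v t'' r' where v: "Poly_Mapping.lookup t v < Poly_Mapping.lookup t' v"
          "t'' \<in> T" "key t'' < key t" "t + Poly_Mapping.single v 1 = t'' + r'"
          using exchange[OF tT _ P_le(2,1)[OF t'(1)]] t'(1) PT by blast
        have "v \<in> V" using v less_P unfolding V_def by blast
        moreover have "0 < Poly_Mapping.lookup s v"
          using arg_cong[OF t'(2), of "\<lambda>p. Poly_Mapping.lookup p v"] v(1) by (simp add: lookup_add)
        ultimately show "\<exists>v\<in>V. 0 < Poly_Mapping.lookup s v" by blast
      qed
    next
      assume "h \<in> ideal.span (var ` V)"
      then show "h * mon t \<in> ideal.span (mon ` P)"
      proof (induction rule: ideal.span_induct_alt)
        case (step c x y)
        then obtain v where v: "x = var v" "v \<in> V" by blast
        then obtain t'' r where t'': "t'' \<in> P" "t + Poly_Mapping.single v 1 = t'' + r"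
          unfolding V_def by blast
        have "(mon (t + Poly_Mapping.single v 1) :: ('n, 'k) polyring) \<in> ideal.span (mon ` P)"
          using t'' by (rule mon_in_span)
        then have "var v * mon t \<in> (ideal.span (mon ` P) :: ('n, 'k) polyring set)"
          by (simp add: var_def mult_single add.commute)
        then have "c * (var v * mon t) + y * mon t \<in> ideal.span (mon ` P)"
          using step.IH by (rule ideal.span_add[OF ideal.span_scale])
        then show ?case by (simp only: v distrib_right mult.assoc)
      qed (simp add: ideal.span_zero)
    qed
    then show ?thesis using colon_iff by blast
  qed
  moreover have "us \<noteq> []" "distinct us"
    using T ts inj by (auto simp: us_def distinct_map intro: inj_on_subset)
  ultimately show ?thesis unfolding has_linear_quotients_def by blast
qed

section \<open>Powers of a complementary edge ideal\<close>

definition edge_degree :: "'n set multiset \<Rightarrow> 'n \<Rightarrow> nat" where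
  "edge_degree M v = size {#e \<in># M. v \<in> e#}"

text \<open>
  In a product of \<open>k\<close> generators a variable \<open>v\<close> is missing from the factors whose edge contains
  \<open>v\<close> and occurs once in each of the others. The additive form avoids the truncated subtraction of
  natural numbers.
\<close>

definition power_exponents :: "'n set set \<Rightarrow> nat \<Rightarrow> ('n \<Rightarrow>\<^sub>0 nat) set" where
  "power_exponents E k = {t. \<exists>M. set_mset M \<subseteq> E \<and> size M = k \<and>
     (\<forall>v. Poly_Mapping.lookup t v + edge_degree M v = k)}"

lemma edge_degree_empty [simp]: "edge_degree {#} v = 0"
  by (simp add: edge_degree_def)

lemma edge_degree_add_mset [simp]:
  "edge_degree (add_mset e M) v = edge_degree M v + (if v \<in> e then 1 else 0)"
  by (simp add: edge_degree_def)

lemma edge_degree_le_size: "edge_degree M v \<le> size M"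
  by (simp add: edge_degree_def size_filter_mset_lesseq)

lemma edge_degree_pos:
  assumes "0 < edge_degree M v" "set_mset M \<subseteq> E"
  shows "v \<in> \<Union>E"
proof -
  obtain e where "e \<in># {#e \<in># M. v \<in> e#}"
    using assms(1) by (auto simp: edge_degree_def nonempty_has_size[symmetric] dest: multiset_nonemptyE)
  with assms(2) show ?thesis by auto
qed

lemma sum_edge_degree:
  fixes C :: "'n::finite set"
  shows "(\<Sum>v\<in>C. edge_degree M v) = (\<Sum>e\<in>#M. card (C \<inter> e))"
proof (induction M)
  case (add e M)
  have "(\<Sum>v\<in>C. if v \<in> e then 1 else 0) = card (C \<inter> e)"
    by (simp add: sum.If_cases Int_def)
  then show ?case using add by (simp add: sum.distrib add.commute)
qed simp

lemma handshake:
  fixes E :: "'n::finite set set"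
  assumes "simple_graph E" "set_mset M \<subseteq> E"
  shows "(\<Sum>v\<in>UNIV. edge_degree M v) = 2 * size M"
proof -
  have "(\<Sum>v\<in>UNIV. edge_degree M v) = (\<Sum>e\<in>#M. card e)" by (simp add: sum_edge_degree)
  also have "\<dots> = (\<Sum>e\<in>#M. 2)"
    using assms by (intro arg_cong[of _ _ sum_mset] image_mset_cong) (auto simp: simple_graph_def)
  finally show ?thesis by simp
qed

lemma power_exponents_of_multiset:
  fixes E :: "'n::finite set set"
  assumes "set_mset M \<subseteq> E" "size M = k"
  obtains t where "t \<in> power_exponents E k" "\<And>v. Poly_Mapping.lookup t v + edge_degree M v = k"
proof -
  have "Poly_Mapping.lookup (Abs_poly_mapping (\<lambda>v. k - edge_degree M v)) v + edge_degree M v = k" for v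
    using edge_degree_le_size[of M v] assms(2) by simp
  then show thesis using that assms unfolding power_exponents_def by blast
qed

lemma total_degree_power_exponents:
  fixes E :: "'n::finite set set"
  assumes "simple_graph E" "t \<in> power_exponents E k"
  shows "total_degree t = k * card (UNIV :: 'n set) - 2 * k"
proof -
  obtain M where M: "set_mset M \<subseteq> E" "size M = k"
    "\<And>v. Poly_Mapping.lookup t v + edge_degree M v = k"
    using assms(2) by (auto simp: power_exponents_def)
  have "total_degree t + 2 * k = (\<Sum>v\<in>UNIV. Poly_Mapping.lookup t v + edge_degree M v)"
    using handshake[OF assms(1) M(1)] M(2) by (simp add: total_degree_def sum.distrib)
  also have "\<dots> = k * card (UNIV :: 'n set)" by (simp add: M(3))
  finally show ?thesis by simp
qed

lemma finite_power_exponents: "finite (power_exponents E k :: ('n::finite \<Rightarrow>\<^sub>0 nat) set)"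
proof -
  have "Poly_Mapping.lookup ` power_exponents E k \<subseteq>
      {f :: 'n \<Rightarrow> nat. \<forall>v. (v \<in> UNIV \<longrightarrow> f v \<in> {..k}) \<and> (v \<notin> UNIV \<longrightarrow> f v = 0)}"
    by (auto simp: power_exponents_def) (metis le_add1)
  then have "finite (Poly_Mapping.lookup ` (power_exponents E k :: ('n \<Rightarrow>\<^sub>0 nat) set))"
    by (rule finite_subset) (intro finite_set_of_finite_funs; simp)
  then show ?thesis
    by (rule finite_imageD) (rule inj_onI, rule poly_mapping_eqI, simp)
qed

lemma ideal_mult_monomial_ideals:
  "ideal_mult (ideal.span (mon ` A)) (ideal.span (mon ` B)) =
    (ideal.span (mon ` {s + t | s t. s \<in> A \<and> t \<in> B}) :: ('n, 'k::comm_ring_1) polyring set)"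
  (is "_ = ideal.span (mon ` ?AB)")
proof
  have "a * b \<in> ideal.span (mon ` ?AB)"
    if a: "a \<in> ideal.span (mon ` A)" and b: "b \<in> ideal.span (mon ` B)" for a b :: "('n, 'k) polyring"
    unfolding mem_monomial_ideal_iff
  proof
    fix t assume "t \<in> Poly_Mapping.keys (a * b)"
    then obtain p q where pq: "t = p + q" "p \<in> Poly_Mapping.keys a" "q \<in> Poly_Mapping.keys b"
      by (rule keys_times_subset)
    then obtain s1 r1 s2 r2 where "s1 \<in> A" "p = s1 + r1" "s2 \<in> B" "q = s2 + r2"
      using a b unfolding mem_monomial_ideal_iff by meson
    then show "\<exists>s\<in>?AB. \<exists>r. t = s + r"
      using pq(1) by (intro bexI[of _ "s1 + s2"] exI[of _ "r1 + r2"]) (auto simp: ac_simps)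
  qed
  then show "ideal_mult (ideal.span (mon ` A)) (ideal.span (mon ` B)) \<subseteq>
      (ideal.span (mon ` ?AB) :: ('n, 'k) polyring set)"
    unfolding ideal_mult_def by (intro ideal.span_minimal) auto
  have "mon ` ?AB \<subseteq> {a * b | a b. a \<in> ideal.span (mon ` A) \<and> b \<in> (ideal.span (mon ` B) :: ('n, 'k) polyring set)}"
  proof
    fix u :: "('n, 'k) polyring" assume "u \<in> mon ` ?AB"
    then obtain s t where st: "s \<in> A" "t \<in> B" "u = mon (s + t)" by blast
    have "u = mon s * mon t" by (simp add: st(3) mult_single)
    moreover have "mon s \<in> (ideal.span (mon ` A) :: ('n, 'k) polyring set)"
      "mon t \<in> (ideal.span (mon ` B) :: ('n, 'k) polyring set)"
      using st by (auto intro: ideal.span_base)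
    ultimately show "u \<in> {a * b | a b. a \<in> ideal.span (mon ` A) \<and> b \<in> ideal.span (mon ` B)}"
      unfolding mem_Collect_eq by (intro exI conjI)
  qed
  then show "(ideal.span (mon ` ?AB) :: ('n, 'k) polyring set) \<subseteq>
      ideal_mult (ideal.span (mon ` A)) (ideal.span (mon ` B))"
    unfolding ideal_mult_def by (rule ideal.span_mono)
qed

definition complement_exponent :: "'n::finite set \<Rightarrow> ('n \<Rightarrow>\<^sub>0 nat)" where
  "complement_exponent e = (\<Sum>v\<in>UNIV - e. Poly_Mapping.single v 1)"

lemma lookup_complement_exponent:
  "Poly_Mapping.lookup (complement_exponent e) v = (if v \<in> e then 0 else 1)"
  by (simp add: complement_exponent_def lookup_sum lookup_single when_def)

lemma complementary_edge_ideal_eq: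
  "(complementary_edge_ideal E :: ('n::finite, 'k::comm_ring_1) polyring set) =
    ideal.span (mon ` complement_exponent ` E)"
proof -
  have "(\<Prod>v\<in>A. var v) = (mon (\<Sum>v\<in>A. Poly_Mapping.single v 1) :: ('n, 'k) polyring)" for A
    by (induction A rule: infinite_finite_induct) (auto simp: var_def mult_single)
  then show ?thesis
    by (simp add: complementary_edge_ideal_def complement_exponent_def image_image)
qed

lemma power_exponents_Suc:
  "power_exponents E (Suc k) = {s + t | s t. s \<in> complement_exponent ` E \<and> t \<in> power_exponents E k}"
proof (intro equalityI subsetI)
  fix t assume "t \<in> power_exponents E (Suc k)"
  then obtain M where M: "set_mset M \<subseteq> E" "size M = Suc k"
    "\<And>v. Poly_Mapping.lookup t v + edge_degree M v = Suc k"
    by (auto simp: power_exponents_def)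
  then obtain e N where N: "M = add_mset e N" by (metis size_eq_Suc_imp_eq_union)
  have le: "edge_degree N v \<le> k" for v using edge_degree_le_size[of N v] M(2) N by simp
  have eq: "Poly_Mapping.lookup t v + edge_degree N v + (if v \<in> e then 1 else 0) = Suc k" for v
    using M(3)[of v] by (simp add: N)
  define s where "s = t - complement_exponent e"
  have "Poly_Mapping.lookup s v + edge_degree N v = k" for v
    using eq[of v] le[of v] by (auto simp: s_def lookup_minus lookup_complement_exponent split: if_splits)
  then have "s \<in> power_exponents E k" using M N unfolding power_exponents_def by auto
  moreover have "t = complement_exponent e + s"
  proof (rule poly_mapping_eqI)
    fix v show "Poly_Mapping.lookup t v = Poly_Mapping.lookup (complement_exponent e + s) v"
      using eq[of v] le[of v]
      by (auto simp: s_def lookup_minus lookup_add lookup_complement_exponent split: if_splits)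
  qed
  moreover have "complement_exponent e \<in> complement_exponent ` E" using M(1) N by auto
  ultimately show "t \<in> {s + t | s t. s \<in> complement_exponent ` E \<and> t \<in> power_exponents E k}"
    unfolding mem_Collect_eq by (intro exI conjI)
next
  fix t assume "t \<in> {s + t | s t. s \<in> complement_exponent ` E \<and> t \<in> power_exponents E k}"
  then obtain e s M where "e \<in> E" "t = complement_exponent e + s" "set_mset M \<subseteq> E" "size M = k"
    "\<forall>v. Poly_Mapping.lookup s v + edge_degree M v = k"
    unfolding power_exponents_def by blast
  then show "t \<in> power_exponents E (Suc k)"
    unfolding power_exponents_def
    by (intro CollectI exI[of _ "add_mset e M"]) (auto simp: lookup_add lookup_complement_exponent)
qed

lemma ideal_power_complementary_edge_ideal:
  "ideal_power (complementary_edge_ideal E) k =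
    (ideal.span (mon ` power_exponents E k) :: ('n::finite, 'k::comm_ring_1) polyring set)"
proof (induction k)
  case 0
  have "power_exponents E 0 = {0}"
    by (auto simp: power_exponents_def poly_mapping_eq_iff fun_eq_iff)
  then have "(f :: ('n, 'k) polyring) \<in> ideal.span (mon ` power_exponents E 0)" for f
    unfolding mem_monomial_ideal_iff by simp
  then show ?case by auto
next
  case (Suc k)
  then show ?case
    by (simp only: ideal_power.simps complementary_edge_ideal_eq ideal_mult_monomial_ideals power_exponents_Suc)
qed

section \<open>Degree sequences form a jump system\<close>

lemma edge_degree_less_obtain:
  assumes "edge_degree M v < edge_degree M' v"
  obtains e where "e \<in># M' - M" "v \<in> e"
proof -
  have "filter_mset (\<lambda>e. v \<in> e) (M' - M) \<noteq> {#}"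
  proof
    assume "filter_mset (\<lambda>e. v \<in> e) (M' - M) = {#}"
    then have "filter_mset (\<lambda>e. v \<in> e) M' \<subseteq># filter_mset (\<lambda>e. v \<in> e) M"
      by (simp add: Diff_eq_empty_iff_mset)
    then show False using assms size_mset_mono by (fastforce simp: edge_degree_def)
  qed
  then obtain e where "e \<in># filter_mset (\<lambda>e. v \<in> e) (M' - M)" by (rule multiset_nonemptyE)
  then show thesis using that unfolding set_mset_filter by blast
qed

lemma other_endpoint:
  assumes "simple_graph E" "e \<in> E" "v \<in> e"
  obtains x where "e = {v, x}" "x \<noteq> v"
proof -
  obtain a b where "e = {a, b}" "a \<noteq> b"
    using assms(1,2) by (auto simp: simple_graph_def card_2_iff)
  then show thesis using that[of a] that[of b] assms(3) by (cases "v = a") (auto simp: insert_commute)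
qed

text \<open>
  The signs \<open>s\<close> and \<open>t\<close> are the directions of two unit steps at \<open>v\<close> and \<open>y\<close>, each of which
  leads towards the degree sequence of \<open>M'\<close>; together they lead from the degree sequence of \<open>M\<close> to
  that of \<open>N\<close>. Adding an edge of \<open>M' - M\<close> or removing one of \<open>M - M'\<close> makes the first step at
  \<open>v\<close> and moves the degree at the other end \<open>x\<close> of the edge in the same direction. If this also
  leads towards \<open>M'\<close>, it is the second step. Otherwise undo it by the first step of the same
  statement for the new multiset, which is closer to \<open>M'\<close>, at \<open>x\<close> with opposite sign. Unrolled,
  the induction follows an alternating trail in the difference of \<open>M\<close> and \<open>M'\<close>.
\<close>

lemma degree_jump:
  fixes E :: "'n set set" and s :: int
  assumes E: "simple_graph E" and M: "set_mset M \<subseteq> E" and M': "set_mset M' \<subseteq> E" and s: "s \<in> {1, -1}"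
    and v: "0 < s * (int (edge_degree M' v) - int (edge_degree M v))"
  shows "\<exists>N y t. set_mset N \<subseteq> E \<and> t \<in> {1, -1} \<and>
    (\<forall>z. int (edge_degree N z) = int (edge_degree M z) + (if z = v then s else 0) + (if z = y then t else 0)) \<and>
    0 < t * (int (edge_degree M' y) - int (edge_degree M y) - (if y = v then s else 0))"
  using M s v
proof (induction "size (M - M') + size (M' - M)" arbitrary: M v s rule: less_induct)
  case less
  let ?diff = "\<lambda>M y. int (edge_degree M' y) - int (edge_degree M y)"
  obtain M1 x where M1: "set_mset M1 \<subseteq> E" "x \<noteq> v"
    "\<And>z. int (edge_degree M1 z) = int (edge_degree M z) + (if z = v then s else 0) + (if z = x then s else 0)"
    "size (M1 - M') + size (M' - M1) < size (M - M') + size (M' - M)"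
  proof (cases "s = 1")
    case True
    then have "edge_degree M v < edge_degree M' v" using less.prems by simp
    then obtain e where e: "e \<in># M' - M" "v \<in> e" by (rule edge_degree_less_obtain)
    have eE: "e \<in> E" using e(1) M' by (auto dest: in_diffD)
    then obtain x where x: "e = {v, x}" "x \<noteq> v"
      using other_endpoint[OF E _ e(2)] by blast
    have diff1: "add_mset e M - M' = M - M'"
      using e(1) by (intro multiset_eqI) (auto simp: in_diff_count)
    have diff2: "M' - add_mset e M = (M' - M) - {#e#}"
      by (intro multiset_eqI) auto
    have smaller: "size (M' - add_mset e M) < size (M' - M)"
      unfolding diff2 by (rule size_Diff1_less) (rule e(1))
    show thesis
    proof (rule that[of "add_mset e M" x])
      show "int (edge_degree (add_mset e M) z) =
          int (edge_degree M z) + (if z = v then s else 0) + (if z = x then s else 0)" for z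
        using x True by simp
    qed (use less.prems(1) eE x(2) smaller diff1 in simp_all)
  next
    case False
    then have s: "s = -1" using less.prems(2) by simp
    then have "edge_degree M' v < edge_degree M v" using less.prems by simp
    then obtain e where e: "e \<in># M - M'" "v \<in> e" by (rule edge_degree_less_obtain)
    have eM: "e \<in># M" using e(1) by (auto dest: in_diffD)
    then have eE: "e \<in> E" using less.prems(1) by auto
    then obtain x where x: "e = {v, x}" "x \<noteq> v"
      using other_endpoint[OF E _ e(2)] by blast
    obtain N where N: "M = add_mset e N" using eM by (metis mset_add)
    have diff1: "M' - N = M' - M"
      using e(1) unfolding N by (intro multiset_eqI) (auto simp: in_diff_count)
    have diff2: "N - M' = (M - M') - {#e#}"
      unfolding N by (intro multiset_eqI) auto
    have smaller: "size (N - M') < size (M - M')"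
      unfolding diff2 by (rule size_Diff1_less) (rule e(1))
    show thesis
    proof (rule that[of N x])
      show "int (edge_degree N z) =
          int (edge_degree M z) + (if z = v then s else 0) + (if z = x then s else 0)" for z
        using x s by (simp add: N)
      show "set_mset N \<subseteq> E" using less.prems(1) by (simp add: N)
    qed (use x(2) smaller diff1 in simp_all)
  qed
  show ?case
  proof (cases "0 < s * ?diff M x")
    case True
    then show ?thesis
      using M1 less.prems by (intro exI[of _ M1] exI[of _ x] exI[of _ s]) auto
  next
    case False
    \<comment> \<open>the change at \<open>x\<close> leads away from \<open>M'\<close>\<close>
    have ms: "- s \<in> {1, -1}" using less.prems(2) by auto
    have "s * s = 1" using less.prems(2) by auto
    then have "0 < (- s) * ?diff M1 x"
      using False M1(2) M1(3)[of x] by (simp add: algebra_simps)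
    from less.hyps[OF M1(4) M1(1) ms this] obtain N y t where N: "set_mset N \<subseteq> E" "t \<in> {1, -1}"
      "\<And>z. int (edge_degree N z) = int (edge_degree M1 z) + (if z = x then - s else 0) + (if z = y then t else 0)"
      "0 < t * (?diff M1 y - (if y = x then - s else 0))" by blast
    have "int (edge_degree N z) = int (edge_degree M z) + (if z = v then s else 0) + (if z = y then t else 0)" for z
      using N(3)[of z] M1(3)[of z] by simp
    moreover have "?diff M1 y - (if y = x then - s else 0) = ?diff M y - (if y = v then s else 0)"
      using M1(3)[of y] by simp
    ultimately show ?thesis using N by (intro exI[of _ N] exI[of _ y] exI[of _ t]) auto
  qed
qed

section \<open>Linear quotients for connected graphs\<close>

text \<open>
  Start with a downward step at \<open>v\<close>. If the second step of \<open>degree_jump\<close> goes up, it does so at a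
  vertex where the degree sequences differ, so its rank is below that of \<open>v\<close>. If it goes down, at
  \<open>y\<close> say, an edge is missing, and an edge joining \<open>y\<close> to a vertex \<open>w\<close> of smaller rank
  restores the degree at \<open>y\<close> and raises that at \<open>w\<close>. For the root \<open>y\<close> take as \<open>w\<close> the second
  vertex in the ranking, whose only neighbour of smaller rank is the root. This \<open>w\<close> differs from
  \<open>v\<close>: otherwise the two sequences would differ only at \<open>v\<close> and the root, where \<open>M\<close> has the
  larger degrees, contrary to the equality of their sums.
\<close>

lemma degree_exchange:
  fixes E :: "'n::finite set set" and rank :: "'n \<Rightarrow> nat" and root :: 'n
  assumes E: "simple_graph E" and inj: "inj rank"
    and nbr: "\<And>y. y \<in> \<Union>E \<Longrightarrow> y \<noteq> root \<Longrightarrow> \<exists>w. {y, w} \<in> E \<and> rank w < rank y"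
    and M: "set_mset M \<subseteq> E" and M': "set_mset M' \<subseteq> E" and size_eq: "size M = size M'"
    and v: "edge_degree M' v < edge_degree M v"
    and top: "\<And>z. rank v < rank z \<Longrightarrow> edge_degree M z = edge_degree M' z"
  shows "\<exists>N w. set_mset N \<subseteq> E \<and> size N = size M \<and> rank w < rank v \<and>
    (\<forall>z. edge_degree N z + (if z = v then 1 else 0) = edge_degree M z + (if z = w then 1 else 0))"
proof -
  define \<delta> where "\<delta> z = int (edge_degree M' z) - int (edge_degree M z)" for z
  have root_least: "rank root \<le> rank z" if "z \<in> \<Union>E" for z
    using that
  proof (induction "rank z" arbitrary: z rule: less_induct)
    case less
    show ?case
    proof (cases "z = root")
      case False
      then obtain w where "{z, w} \<in> E" "rank w < rank z" using nbr less.prems by blast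
      then show ?thesis using less.hyps[of w] by fastforce
    qed simp
  qed
  have \<delta>_supp: "z \<in> \<Union>E" if "\<delta> z \<noteq> 0" for z
  proof -
    have "0 < edge_degree M z \<or> 0 < edge_degree M' z" using that by (auto simp: \<delta>_def)
    then show ?thesis using edge_degree_pos[OF _ M] edge_degree_pos[OF _ M'] by blast
  qed
  have \<delta>_top: "rank z \<le> rank v" if "\<delta> z \<noteq> 0" for z
  proof (rule ccontr)
    assume "\<not> rank z \<le> rank v"
    then have "\<delta> z = 0" using top[of z] by (simp add: \<delta>_def)
    with that show False by simp
  qed
  have \<delta>_v: "\<delta> v < 0" using v by (simp add: \<delta>_def)
  have sum_\<delta>: "(\<Sum>z\<in>UNIV. \<delta> z) = 0"
  proof -
    have "(\<Sum>z\<in>UNIV. \<delta> z) = int (\<Sum>z\<in>UNIV. edge_degree M' z) - int (\<Sum>z\<in>UNIV. edge_degree M z)"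
      by (simp add: \<delta>_def sum_subtractf)
    then show ?thesis by (simp only: handshake[OF E M] handshake[OF E M'] size_eq)
  qed
  have "0 < (-1) * (int (edge_degree M' v) - int (edge_degree M v))"
    using v by simp
  from degree_jump[OF E M M' _ this] obtain N y t where N: "set_mset N \<subseteq> E" "t \<in> {1, -1}"
    "\<And>z. int (edge_degree N z) = int (edge_degree M z) + (if z = v then -1 else 0) + (if z = y then t else 0)"
    "0 < t * (\<delta> y - (if y = v then -1 else 0))"
    unfolding \<delta>_def by blast
  have "(\<Sum>z\<in>UNIV. int (edge_degree N z)) = (\<Sum>z\<in>UNIV. int (edge_degree M z)) - 1 + t"
    by (simp add: N(3) sum.distrib)
  then have "int (2 * size N) = int (2 * size M) - 1 + t"
    unfolding of_nat_sum[symmetric] handshake[OF E N(1)] handshake[OF E M] .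
  then have size_N: "2 * int (size N) = 2 * int (size M) - 1 + t" by simp
  have inj_less: "rank z < rank w" if "rank z \<le> rank w" "z \<noteq> w" for z w
    using that inj by (metis injD le_neq_implies_less)
  show ?thesis
  proof (cases "t = 1")
    case True
    with N(4) \<delta>_v have "y \<noteq> v" "\<delta> y \<noteq> 0" by (auto split: if_splits)
    then have "rank y < rank v" using \<delta>_top inj_less by blast
    moreover have "edge_degree N z + (if z = v then 1 else 0) = edge_degree M z + (if z = y then 1 else 0)" for z
      using N(3)[of z] True by (auto split: if_splits)
    ultimately show ?thesis using N(1) size_N True by (intro exI[of _ N] exI[of _ y]) auto
  next
    case False
    then have t: "t = -1" using N(2) by simp
    have \<delta>_y: "\<delta> y < 0" using N(4) t by (simp split: if_splits)
    then have yE: "y \<in> \<Union>E" and y_le: "rank y \<le> rank v" using \<delta>_supp \<delta>_top by auto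
    have size_N': "Suc (size N) = size M" using size_N t by simp
    \<comment> \<open>an edge at \<open>y\<close> whose other end has small rank completes \<open>N\<close>\<close>
    have "\<exists>w. {y, w} \<in> E \<and> w \<noteq> y \<and> rank w < rank v"
    proof (cases "y = root")
      case False
      then obtain w where "{y, w} \<in> E" "rank w < rank y" using nbr yE by blast
      then show ?thesis using y_le by (intro exI[of _ w]) auto
    next
      case True
      have "v \<noteq> root"
      proof
        assume "v = root"
        then have "\<delta> z = 0" if "z \<noteq> v" for z
          using that root_least \<delta>_supp[of z] \<delta>_top[of z] inj_less[of root z] by force
        then have "(\<Sum>z\<in>UNIV. \<delta> z) = \<delta> v" by (subst sum.remove[of _ v]) auto
        with sum_\<delta> \<delta>_v show False by simp
      qed
      have vE: "v \<in> \<Union>E" using \<delta>_supp \<delta>_v by force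
      define w where "w = (ARG_MIN rank z. z \<in> \<Union>E \<and> z \<noteq> root)"
      have w: "w \<in> \<Union>E" "w \<noteq> root"
        using arg_min_natI[of "\<lambda>z. z \<in> \<Union>E \<and> z \<noteq> root" v rank] vE \<open>v \<noteq> root\<close> by (auto simp: w_def)
      have w_least: "rank w \<le> rank z" if "z \<in> \<Union>E" "z \<noteq> root" for z
        using arg_min_nat_le[of "\<lambda>z. z \<in> \<Union>E \<and> z \<noteq> root" z rank] that by (auto simp: w_def)
      obtain u where u: "{w, u} \<in> E" "rank u < rank w" using nbr w by blast
      then have "u = root" using w_least[of u] by force
      then have edge: "{y, w} \<in> E" using u True by (simp add: insert_commute)
      have "w \<noteq> v"
      proof
        assume "w = v"
        then have "\<delta> z = 0" if "z \<noteq> v" "z \<noteq> root" for z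
          using that w_least[of z] \<delta>_supp[of z] \<delta>_top[of z] inj_less[of v z] by force
        then have "(\<Sum>z\<in>UNIV. \<delta> z) = (\<Sum>z\<in>{v, root}. \<delta> z)"
          by (intro sum.mono_neutral_right) auto
        with sum_\<delta> \<delta>_v \<delta>_y True \<open>v \<noteq> root\<close> show False by simp
      qed
      then have "rank w < rank v" using w_least[OF vE \<open>v \<noteq> root\<close>] inj_less by blast
      then show ?thesis using edge w True by blast
    qed
    then obtain w where w: "{y, w} \<in> E" "w \<noteq> y" "rank w < rank v" by blast
    have "edge_degree (add_mset {y, w} N) z + (if z = v then 1 else 0) =
        edge_degree M z + (if z = w then 1 else 0)" for z
      using N(3)[of z] t w(2) by (auto split: if_splits)
    then show ?thesis using N(1) size_N' w
      by (intro exI[of _ "add_mset {y, w} N"] exI[of _ w]) auto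
  qed
qed

text \<open>
  If the base exceeds the sum of the digits \<open>d\<close>, then all digits below a position together weigh
  less than one unit there. So \<open>d'\<close>, whose weighted sum is not larger, cannot exceed \<open>d\<close> at the
  topmost position where they differ. In this way a number encodes the comparison of degree
  sequences.
\<close>

lemma weighted_sum_top_difference:
  fixes d d' :: "'n::finite \<Rightarrow> nat" and rank :: "'n \<Rightarrow> nat"
  assumes inj: "inj rank" and neq: "d \<noteq> d'" and small: "(\<Sum>z\<in>UNIV. d z) < B"
    and le: "(\<Sum>z\<in>UNIV. d' z * B ^ rank z) \<le> (\<Sum>z\<in>UNIV. d z * B ^ rank z)"
  shows "\<exists>v. d' v < d v \<and> (\<forall>z. rank v < rank z \<longrightarrow> d z = d' z)"
proof -
  let ?D = "{z. d z \<noteq> d' z}"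
  have D: "finite ?D" "?D \<noteq> {}" using neq by auto
  have "Max (rank ` ?D) \<in> rank ` ?D" using D by (intro Max_in) auto
  then obtain v where v: "d v \<noteq> d' v" "rank v = Max (rank ` ?D)" by auto
  have top: "d z = d' z" if "rank v < rank z" for z
  proof (rule ccontr)
    assume "d z \<noteq> d' z"
    then have "rank z \<le> rank v" unfolding v(2) by (intro Max_ge) auto
    with that show False by simp
  qed
  have "d' v < d v"
  proof (rule ccontr)
    assume "\<not> d' v < d v"
    with v have less: "Suc (d v) \<le> d' v" by simp
    let ?L = "{z. rank z < rank v}" and ?H = "{z. rank v < rank z}"
    have part: "UNIV = ?L \<union> ({v} \<union> ?H)"
    proof -
      have "z = v" if "rank z = rank v" for z using that inj by (simp add: injD)
      then show ?thesis by (auto simp: set_eq_iff) (metis nat_neq_iff)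
    qed
    have split: "sum f UNIV = sum f ?L + (f v + sum f ?H)" for f :: "'n \<Rightarrow> nat"
      by (subst part) (subst sum.union_disjoint; auto)
    have "B * (\<Sum>z\<in>?L. d z * B ^ rank z) = (\<Sum>z\<in>?L. d z * B ^ Suc (rank z))"
      by (simp add: sum_distrib_left ac_simps)
    also have "\<dots> \<le> (\<Sum>z\<in>?L. d z * B ^ rank v)"
      using small by (intro sum_mono mult_left_mono power_increasing) auto
    also have "\<dots> \<le> (\<Sum>z\<in>UNIV. d z) * B ^ rank v"
      by (simp add: sum_distrib_right[symmetric] sum_mono2)
    also have "\<dots> < B * B ^ rank v" using small by simp
    finally have "(\<Sum>z\<in>?L. d z * B ^ rank z) < B ^ rank v" by simp
    then have "(\<Sum>z\<in>UNIV. d z * B ^ rank z) <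
        B ^ rank v + (d v * B ^ rank v + (\<Sum>z\<in>?H. d z * B ^ rank z))"
      by (subst split) simp
    also have "\<dots> = Suc (d v) * B ^ rank v + (\<Sum>z\<in>?H. d' z * B ^ rank z)"
      using top by simp
    also have "\<dots> \<le> d' v * B ^ rank v + (\<Sum>z\<in>?H. d' z * B ^ rank z)"
      using less by (intro add_right_mono mult_right_mono) auto
    also have "\<dots> \<le> (\<Sum>z\<in>UNIV. d' z * B ^ rank z)"
      by (subst split[of "\<lambda>z. d' z * B ^ rank z"]) simp
    finally show False using le by simp
  qed
  with top show ?thesis by blast
qed

text \<open>
  Rank by the distance from the root. Distances are scaled so that a numbering of the vertices can
  break ties.
\<close>

lemma connected_rank:
  fixes E :: "'n::finite set set" and root :: 'n
  assumes conn: "\<And>v. v \<in> \<Union>E \<Longrightarrow> (root, v) \<in> (adjacency E)\<^sup>*"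
  obtains rank :: "'n \<Rightarrow> nat" where "inj rank"
    "\<And>y. y \<in> \<Union>E \<Longrightarrow> y \<noteq> root \<Longrightarrow> \<exists>w. {y, w} \<in> E \<and> rank w < rank y"
proof -
  obtain idx :: "'n \<Rightarrow> nat" and N where idx: "idx ` UNIV = {i. i < N}" "inj idx"
    using finite_imp_inj_to_nat_seg[of "UNIV :: 'n set"] by auto
  have idx_less: "idx v < N" for v using idx(1) by blast
  define dist where "dist v = (LEAST n. (root, v) \<in> adjacency E ^^ n)" for v
  have dist: "(root, v) \<in> adjacency E ^^ dist v" if "v \<in> \<Union>E" for v
    using conn[OF that] unfolding dist_def rtrancl_power by (rule LeastI_ex)
  define rank where "rank v = dist v * N + idx v" for v
  have "inj rank"
  proof (rule injI)
    fix x y assume "rank x = rank y"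
    then have "(dist x * N + idx x) mod N = (dist y * N + idx y) mod N" by (simp add: rank_def)
    then have "idx x = idx y" using idx_less by simp
    then show "x = y" using idx(2) by (rule injD[rotated])
  qed
  moreover have "\<exists>w. {y, w} \<in> E \<and> rank w < rank y" if y: "y \<in> \<Union>E" "y \<noteq> root" for y
  proof -
    have dy: "(root, y) \<in> adjacency E ^^ dist y" using dist y by blast
    then obtain m where m: "dist y = Suc m" using y(2) by (cases "dist y") auto
    with dy obtain w where w: "(root, w) \<in> adjacency E ^^ m" "(w, y) \<in> adjacency E" by auto
    have "dist w \<le> m" unfolding dist_def by (rule Least_le) (rule w(1))
    then have "dist w * N \<le> m * N" by (rule mult_le_mono1)
    then have "dist w * N + idx w < m * N + N" using idx_less[of w] by (rule add_le_less_mono)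
    then have "rank w < rank y" unfolding rank_def m by simp
    moreover have "{y, w} \<in> E" using w(2) by (simp add: adjacency_def insert_commute)
    ultimately show ?thesis by blast
  qed
  ultimately show thesis using that by blast
qed

theorem connected_imp_linear_quotients:
  fixes E :: "'n::finite set set" and root :: 'n
  assumes E: "simple_graph E" "E \<noteq> {}"
    and conn: "\<And>v. v \<in> \<Union>E \<Longrightarrow> (root, v) \<in> (adjacency E)\<^sup>*"
  shows "has_linear_quotients (ideal_power (complementary_edge_ideal E) k :: ('n, 'k::comm_ring_1) polyring set)"
proof -
  let ?T = "power_exponents E k"
  obtain rank :: "'n \<Rightarrow> nat" where inj: "inj rank" and
    nbr: "\<And>y. y \<in> \<Union>E \<Longrightarrow> y \<noteq> root \<Longrightarrow> \<exists>w. {y, w} \<in> E \<and> rank w < rank y"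
    using connected_rank[OF conn] by blast
  obtain e where e: "e \<in> E" using E(2) by blast
  \<comment> \<open>the degrees of \<open>k\<close> edges add up to \<open>2 * k\<close>\<close>
  define B where "B = 2 * k + 1"
  define key where "key t = (\<Sum>z\<in>UNIV. (k - Poly_Mapping.lookup t z) * B ^ rank z)" for t
  have "set_mset (replicate_mset k e) \<subseteq> E" using e by auto
  then obtain t where "t \<in> ?T" by (rule power_exponents_of_multiset[where k = k]) simp
  then have nonempty: "?T \<noteq> {}" by blast
  have key_M: "key t = (\<Sum>z\<in>UNIV. edge_degree M z * B ^ rank z)"
    if "\<And>v. Poly_Mapping.lookup t v + edge_degree M v = k" for t M
  proof -
    have "k - Poly_Mapping.lookup t z = edge_degree M z" for z using that[of z] by simp
    then show ?thesis by (simp add: key_def)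
  qed
  show ?thesis
    unfolding ideal_power_complementary_edge_ideal
  proof (rule has_linear_quotients_by_key[OF finite_power_exponents nonempty
        total_degree_power_exponents[OF E(1)], where key = key])
    fix t t' assume t: "t \<in> ?T" and t': "t' \<in> ?T" and neq: "t' \<noteq> t" and le: "key t' \<le> key t"
    obtain M where M: "set_mset M \<subseteq> E" "size M = k" "\<And>v. Poly_Mapping.lookup t v + edge_degree M v = k"
      using t by (auto simp: power_exponents_def)
    obtain M' where M': "set_mset M' \<subseteq> E" "size M' = k" "\<And>v. Poly_Mapping.lookup t' v + edge_degree M' v = k"
      using t' by (auto simp: power_exponents_def)
    have "edge_degree M \<noteq> edge_degree M'"
    proof
      assume eq: "edge_degree M = edge_degree M'"
      have "t' = t"
      proof (rule poly_mapping_eqI)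
        fix v show "Poly_Mapping.lookup t' v = Poly_Mapping.lookup t v"
          using M(3)[of v] M'(3)[of v] eq by simp
      qed
      with neq show False ..
    qed
    moreover have "(\<Sum>z\<in>UNIV. edge_degree M z) < B"
      using handshake[OF E(1) M(1)] M(2) by (simp add: B_def)
    ultimately obtain v where v: "edge_degree M' v < edge_degree M v"
      and top: "\<And>z. rank v < rank z \<Longrightarrow> edge_degree M z = edge_degree M' z"
      using weighted_sum_top_difference[OF inj, of "edge_degree M" "edge_degree M'" B] le
      unfolding key_M[OF M(3)] key_M[OF M'(3)] by blast
    have "size M = size M'" using M M' by simp
    from degree_exchange[OF E(1) inj nbr M(1) M'(1) this v top] obtain N w where
      N: "set_mset N \<subseteq> E" "size N = size M" "rank w < rank v"
        "\<And>z. edge_degree N z + (if z = v then 1 else 0) = edge_degree M z + (if z = w then 1 else 0)"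
      by blast
    obtain t'' where "t'' \<in> ?T" and t'': "\<And>z. Poly_Mapping.lookup t'' z + edge_degree N z = k"
      using power_exponents_of_multiset[OF N(1), of k] N(2) M(2) by auto
    have "key t'' < key t"
    proof -
      have add_one: "(\<Sum>z\<in>UNIV. (f z + (if z = x then 1 else 0)) * B ^ rank z) =
          (\<Sum>z\<in>UNIV. f z * B ^ rank z) + B ^ rank x" for f x
      proof -
        have "(f z + (if z = x then 1 else 0)) * B ^ rank z =
            f z * B ^ rank z + (if z = x then B ^ rank z else 0)" for z by simp
        then show ?thesis by (simp add: sum.distrib)
      qed
      have "(\<Sum>z\<in>UNIV. edge_degree N z * B ^ rank z) + B ^ rank v =
          (\<Sum>z\<in>UNIV. (edge_degree N z + (if z = v then 1 else 0)) * B ^ rank z)"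
        by (rule add_one[symmetric])
      also have "\<dots> = (\<Sum>z\<in>UNIV. edge_degree M z * B ^ rank z) + B ^ rank w"
        unfolding N(4) by (rule add_one)
      finally have "key t'' + B ^ rank v = key t + B ^ rank w"
        by (simp only: key_M[OF M(3)] key_M[OF t''])
      moreover have "k \<noteq> 0" using v M(2) edge_degree_le_size[of M v] by linarith
      then have "B ^ rank w < B ^ rank v"
        using N(3) by (intro power_strict_increasing) (auto simp: B_def)
      ultimately show ?thesis by linarith
    qed
    moreover note \<open>t'' \<in> ?T\<close>
    moreover have "t + Poly_Mapping.single v 1 = t'' + Poly_Mapping.single w 1"
    proof (rule poly_mapping_eqI)
      fix z
      show "Poly_Mapping.lookup (t + Poly_Mapping.single v 1) z = Poly_Mapping.lookup (t'' + Poly_Mapping.single w 1) z"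
        using N(4)[of z] M(3)[of z] t''[of z] by (auto simp: lookup_add lookup_single when_def split: if_splits)
    qed
    moreover have "Poly_Mapping.lookup t v < Poly_Mapping.lookup t' v"
      using M(3)[of v] M'(3)[of v] v by simp
    ultimately show "\<exists>v. Poly_Mapping.lookup t v < Poly_Mapping.lookup t' v \<and>
        (\<exists>t''\<in>?T. key t'' < key t \<and> (\<exists>r. t + Poly_Mapping.single v 1 = t'' + r))"
      by blast
  qed
qed

section \<open>An obstruction to linear resolutions\<close>

lemma sum_vscale_vec_of: "(\<Sum>j\<in>J. vscale (f j) (vec_of (p j))) = vec_of (\<Sum>j\<in>J. f j * p j)"
  by (rule ext) (simp add: sum_vscale_apply vec_of_def)

lemma mem_monomial_ideal_degree:
  fixes f :: "('n::finite, 'k::comm_ring_1) polyring"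
  assumes "\<And>t. t \<in> A \<Longrightarrow> total_degree t = d" "f \<in> ideal.span (mon ` A)" "t \<in> Poly_Mapping.keys f"
  shows "d \<le> total_degree t" "total_degree t = d \<Longrightarrow> t \<in> A"
proof -
  obtain s r where s: "s \<in> A" "t = s + r" using assms(2,3) unfolding mem_monomial_ideal_iff by blast
  then have deg: "total_degree t = d + total_degree r" using assms(1) by simp
  then show "d \<le> total_degree t" by simp
  assume "total_degree t = d"
  with deg have "r = 0" by (simp flip: total_degree_eq_0_iff)
  with s show "t \<in> A" by simp
qed

text \<open>
  The monomial generators split into two classes, given by \<open>R\<close>, such that multiples of generators
  from different classes by single variables never coincide. Projecting each generator to the first class
  defines a linear map \<open>\<phi>\<close> on coefficient vectors, and \<open>\<phi>\<close> kills every relation with linear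
  coefficients, since the terms from the two classes cancel separately. But \<open>\<phi>\<close> does not kill the
  relation \<open>w * u - u * w = 0\<close> for generators \<open>u\<close>, \<open>w\<close> of different classes.

  The given minimal generators need not be monomials. Minimality forces them to have degree \<open>d\<close>, so
  that they and the monomials of degree \<open>d\<close> in the ideal are combinations of each other with
  constant coefficients; this is what makes the projection to a class available.
\<close>

theorem split_generators_imp_no_linear_resolution:
  fixes A :: "('n::finite \<Rightarrow>\<^sub>0 nat) set" and I :: "('n, 'k::comm_ring_1) polyring set"
  assumes I: "I = ideal.span (mon ` A)" and deg: "\<And>t. t \<in> A \<Longrightarrow> total_degree t = d"
    and QR: "\<And>s t. total_degree s = 1 \<Longrightarrow> t \<in> A \<Longrightarrow> Q (s + t) \<longleftrightarrow> R t"
    and u: "u \<in> A" "R u" and w: "w \<in> A" "\<not> R w"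
  shows "\<not> has_linear_resolution I"
proof
  assume "has_linear_resolution I"
  then obtain a g d' where res: "minimal_graded_free_resolution I a g"
    and gen0: "generated_in_degree (a 0) (syzygy_module I g 0) d'"
    and gen: "\<And>i. i > 0 \<Longrightarrow> syzygy_module I g i = {0} \<or> generated_in_degree (a i) (syzygy_module I g i) (d' + i)"
    unfolding has_linear_resolution_def by blast
  define ms where "ms = g 0"
  define b where "b = a 1"
  define p where "p i = (ms ! i) 0" for i
  let ?n = "length ms"
  have a0: "a 0 = [0]" using res by (simp add: minimal_graded_free_resolution_def)
  have "minimal_homogeneous_generators [0] (vec_of ` I) ms b"
    using res a0 syzygy_module_0_eq[of I g] unfolding minimal_graded_free_resolution_def ms_def b_def
    by (metis One_nat_def)
  then have len: "length b = ?n" and hom: "\<And>i. i < ?n \<Longrightarrow> homogeneous_vec [0] (b ! i) (ms ! i)"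
    and span_ms: "free.span (set ms) = vec_of ` I"
    and irred: "\<And>i. i < ?n \<Longrightarrow> ms ! i \<notin> free.span (set (take i ms @ drop (Suc i) ms))"
    by (auto simp: minimal_homogeneous_generators_def)
  have ms_p: "ms ! i = vec_of (p i)" if "i < ?n" for i
  proof
    fix j show "(ms ! i) j = vec_of (p i) j"
      using hom[OF that] by (cases "j = 0") (auto simp: p_def vec_of_def homogeneous_vec_def)
  qed
  have keys_p: "total_degree t = b ! i" if "i < ?n" "t \<in> Poly_Mapping.keys (p i)" for i t
    using hom[OF that(1)] that(2) by (simp add: homogeneous_vec_def p_def)
  have p_I: "p i \<in> I" if "i < ?n" for i
  proof -
    have "ms ! i \<in> free.span (set ms)" using that by (intro free.span_base) simp
    then show ?thesis using span_ms ms_p[OF that] by auto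
  qed
  have keys_I: "d \<le> total_degree t" "total_degree t = d \<Longrightarrow> t \<in> A"
    if "f \<in> I" "t \<in> Poly_Mapping.keys f" for f t
    using mem_monomial_ideal_degree[OF deg that(1)[unfolded I] that(2)] by blast+

  have mon_combination: "\<exists>c. vec_of (mon t) = (\<Sum>j<?n. vscale (c j) (ms ! j)) \<and>
      (\<forall>j<?n. \<forall>s\<in>Poly_Mapping.keys (c j). total_degree s + b ! j = d)" if t: "t \<in> A" for t
  proof -
    have "mon t \<in> I" using t by (simp add: I ideal.span_base)
    then have "vec_of (mon t) \<in> free.span (set ms)" using span_ms by blast
    then obtain c where c: "vec_of (mon t) = (\<Sum>j<?n. vscale (c j) (ms ! j))"
      unfolding set_eq_image[of ms] by (auto simp: free.span_finite_image)
    have "homogeneous_vec [0] d (vec_of (mon t))"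
      using deg[OF t] by (simp add: homogeneous_vec_def vec_of_def)
    from homogeneous_coefficients[OF this c, of "(!) b"] hom show ?thesis
      by (intro exI[of _ "\<lambda>j. restrict_keys (\<lambda>t. total_degree t + b ! j = d) (c j)"])
        (auto simp: keys_restrict_keys)
  qed

  \<comment> \<open>a generator of larger degree would have coefficient zero in every monomial generator and be redundant\<close>
  have b_d: "b ! i = d" if i: "i < ?n" for i
  proof (rule ccontr)
    assume neq: "b ! i \<noteq> d"
    have "d < b ! i"
    proof (rule ccontr)
      assume "\<not> d < b ! i"
      with neq have "b ! i < d" by simp
      have "Poly_Mapping.keys (p i) = {}"
      proof (rule ccontr)
        assume "Poly_Mapping.keys (p i) \<noteq> {}"
        then obtain t where t: "t \<in> Poly_Mapping.keys (p i)" by blast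
        show False using keys_I(1)[OF p_I[OF i] t] keys_p[OF i t] \<open>b ! i < d\<close> by simp
      qed
      then have "ms ! i = 0" using ms_p[OF i] by (simp add: keys_empty_iff vec_of_zero)
      then show False using irred[OF i] free.span_zero by metis
    qed
    have "vec_of (mon t) \<in> free.span (set (take i ms @ drop (Suc i) ms))" if t: "t \<in> A" for t
    proof -
      obtain c where c: "vec_of (mon t) = (\<Sum>j<?n. vscale (c j) (ms ! j))"
        "\<And>j s. j < ?n \<Longrightarrow> s \<in> Poly_Mapping.keys (c j) \<Longrightarrow> total_degree s + b ! j = d"
        using mon_combination[OF t] by blast
      have "Poly_Mapping.keys (c i) = {}" using c(2)[OF i] \<open>d < b ! i\<close> by fastforce
      then have "c i = 0" by (simp add: keys_empty_iff)
      then have "vec_of (mon t) = (\<Sum>j\<in>{..<?n} - {i}. vscale (c j) (ms ! j))"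
        unfolding c(1) using i by (subst sum.remove[of _ i]) auto
      then show ?thesis unfolding set_remove_nth[OF i] by (auto simp: free.span_finite_image)
    qed
    then have "free.span (vec_of ` mon ` A) \<subseteq> free.span (set (take i ms @ drop (Suc i) ms))"
      by (intro free.span_minimal) auto
    moreover have "ms ! i \<in> free.span (vec_of ` mon ` A)"
      using ms_p[OF i] p_I[OF i] by (simp add: span_vec_of I)
    ultimately show False using irred[OF i] by blast
  qed

  have d'_d: "d' = d"
  proof (rule antisym)
    let ?H = "{f \<in> vec_of ` I. homogeneous_vec [0] d' f}"
    have span_H: "free.span ?H = vec_of ` I" and nonzero: "vec_of ` I \<noteq> {0}"
      using gen0 unfolding generated_in_degree_def a0 syzygy_module_0_eq by auto
    have "\<forall>t\<in>Poly_Mapping.keys (f 0). d' \<le> total_degree t" if "f \<in> free.span ?H" for f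
      using that
    proof (induction rule: free.span_induct_alt)
      case (step c f h)
      show ?case
      proof
        fix t assume "t \<in> Poly_Mapping.keys ((vscale c f + h) 0)"
        then have "t \<in> Poly_Mapping.keys (c * f 0) \<union> Poly_Mapping.keys (h 0)"
          using keys_add[of "c * f 0" "h 0"] by (auto simp: vscale_apply)
        then show "d' \<le> total_degree t"
        proof
          assume "t \<in> Poly_Mapping.keys (c * f 0)"
          then show ?thesis using step.hyps by (auto simp: homogeneous_vec_def elim!: keys_times_subset)
        qed (use step.IH in blast)
      qed
    qed simp
    moreover have "vec_of (mon u) \<in> vec_of ` I" using u by (simp add: I ideal.span_base)
    ultimately show "d' \<le> d" using span_H deg[OF u(1)] by fastforce
    have "\<not> ?H \<subseteq> {0}"
    proof
      assume "?H \<subseteq> {0}"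
      then have "free.span ?H \<subseteq> {0}" by (intro free.span_minimal free.subspace_single_0)
      then show False using span_H nonzero free.span_zero[of ?H] by blast
    qed
    then obtain x where x: "x \<in> I" "vec_of x \<noteq> 0" "homogeneous_vec [0] d' (vec_of x)" by blast
    then have "x \<noteq> 0" by (auto simp: vec_of_zero)
    then obtain t where t: "t \<in> Poly_Mapping.keys x" using keys_empty_iff[of x] by blast
    have "total_degree t = d'" using x(3) t by (auto simp: homogeneous_vec_def)
    then show "d \<le> d'" using keys_I(1)[OF x(1) t] by simp
  qed

  have constants: "\<exists>c. mon t = (\<Sum>j<?n. c j * p j) \<and> (\<forall>j<?n. Poly_Mapping.keys (c j) \<subseteq> {0})"
    if t: "t \<in> A" for t
  proof -
    obtain c where c: "vec_of (mon t) = (\<Sum>j<?n. vscale (c j) (ms ! j))"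
      "\<And>j s. j < ?n \<Longrightarrow> s \<in> Poly_Mapping.keys (c j) \<Longrightarrow> total_degree s + b ! j = d"
      using mon_combination[OF t] by blast
    have "vec_of (mon t) = vec_of (\<Sum>j<?n. c j * p j)"
      unfolding c(1) sum_vscale_vec_of[symmetric] using ms_p by (intro sum.cong) auto
    moreover have "Poly_Mapping.keys (c j) \<subseteq> {0}" if "j < ?n" for j
      using c(2)[OF that] b_d[OF that] by (auto simp flip: total_degree_eq_0_iff)
    ultimately show ?thesis by auto
  qed
  obtain \<alpha> where \<alpha>: "mon u = (\<Sum>j<?n. \<alpha> j * p j)" "\<And>j. j < ?n \<Longrightarrow> Poly_Mapping.keys (\<alpha> j) \<subseteq> {0}"
    using constants[OF u(1)] by blast
  obtain \<beta> where \<beta>: "mon w = (\<Sum>j<?n. \<beta> j * p j)" "\<And>j. j < ?n \<Longrightarrow> Poly_Mapping.keys (\<beta> j) \<subseteq> {0}"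
    using constants[OF w(1)] by blast
  have restrict_const: "(\<Sum>j<?n. c j * restrict_keys R (p j)) = restrict_keys R (\<Sum>j<?n. c j * p j)"
    if "\<And>j. j < ?n \<Longrightarrow> Poly_Mapping.keys (c j) \<subseteq> {0}" for c
    unfolding restrict_keys_sum
  proof (rule sum.cong[OF refl])
    fix j assume "j \<in> {..<?n}"
    then have "\<forall>s\<in>Poly_Mapping.keys (c j). s = 0" using that by auto
    then have "restrict_keys R (c j * p j) = restrict_keys (\<lambda>_. True) (c j) * restrict_keys R (p j)"
      by (intro restrict_keys_times) auto
    then show "c j * restrict_keys R (p j) = restrict_keys R (c j * p j)" by (simp add: restrict_keys_id)
  qed

  define \<phi> where "\<phi> h = (\<Sum>j<?n. h j * restrict_keys R (p j))" for h
  have \<phi>_linear: "\<phi> (vscale c h + h') = c * \<phi> h + \<phi> h'" for c h h'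
    by (simp add: \<phi>_def vscale_apply distrib_right sum.distrib sum_distrib_left mult.assoc)
  have \<phi>_relation: "\<phi> h = 0" if h: "h \<in> relation_module ms" "homogeneous_vec b (Suc d) h" for h
  proof -
    have "vec_of (\<Sum>j<?n. h j * p j) = (\<Sum>j<?n. vscale (h j) (ms ! j))"
      unfolding sum_vscale_vec_of[symmetric] using ms_p by (intro sum.cong) auto
    also have "\<dots> = vec_of 0" using h(1) by (simp add: relation_module_def vec_of_zero)
    finally have sum0: "(\<Sum>j<?n. h j * p j) = 0" by simp
    have "h j * restrict_keys R (p j) = restrict_keys Q (h j * p j)" if j: "j < ?n" for j
    proof -
      have "\<forall>s\<in>Poly_Mapping.keys (h j). total_degree s = 1"
        using h(2) j len b_d[OF j] by (auto simp: homogeneous_vec_def)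
      moreover have "\<forall>t\<in>Poly_Mapping.keys (p j). t \<in> A"
        using keys_p[OF j] keys_I(2)[OF p_I[OF j]] b_d[OF j] by auto
      ultimately have "restrict_keys Q (h j * p j) = restrict_keys (\<lambda>_. True) (h j) * restrict_keys R (p j)"
        using QR by (intro restrict_keys_times) auto
      then show ?thesis by (simp add: restrict_keys_id)
    qed
    then have "\<phi> h = restrict_keys Q (\<Sum>j<?n. h j * p j)"
      by (simp add: \<phi>_def restrict_keys_sum)
    then show ?thesis by (simp add: sum0)
  qed
  have \<phi>_zero: "\<phi> h = 0" if "h \<in> relation_module ms" for h
  proof -
    have syz_1: "syzygy_module I g 1 = relation_module ms" by (simp add: ms_def)
    have "relation_module ms = {0} \<or> generated_in_degree b (relation_module ms) (Suc d)"
      using gen[of 1] unfolding syz_1 d'_d b_def by simp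
    then show ?thesis
    proof
      assume "relation_module ms = {0}"
      then have "h = 0" using that by simp
      then show ?thesis by (simp add: \<phi>_def)
    next
      assume "generated_in_degree b (relation_module ms) (Suc d)"
      then have "relation_module ms \<subseteq> free.span {f \<in> relation_module ms. homogeneous_vec b (Suc d) f}"
        unfolding generated_in_degree_def by (elim conjE) (rule equalityD1)
      then have "h \<in> free.span {f \<in> relation_module ms. homogeneous_vec b (Suc d) f}"
        using that by (rule subsetD)
      then show ?thesis
      proof (induction rule: free.span_induct_alt)
        case (step c x y)
        then have "\<phi> x = 0" using \<phi>_relation by blast
        then show ?case using step.IH by (simp only: \<phi>_linear mult_zero_right add_0_right)
      qed (simp add: \<phi>_def)
    qed
  qed

  define f where "f j = (if j < ?n then mon w * \<alpha> j - mon u * \<beta> j else 0)" for j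
  have f_sum: "(\<Sum>j<?n. f j * x j) = mon w * (\<Sum>j<?n. \<alpha> j * x j) - mon u * (\<Sum>j<?n. \<beta> j * x j)" for x
    by (simp add: f_def left_diff_distrib sum_subtractf sum_distrib_left mult.assoc)
  have "(\<Sum>j<?n. vscale (f j) (ms ! j)) = vec_of (\<Sum>j<?n. f j * p j)"
    unfolding sum_vscale_vec_of[symmetric] using ms_p by (intro sum.cong) auto
  also have "\<dots> = 0"
    unfolding f_sum \<alpha>(1)[symmetric] \<beta>(1)[symmetric] by (simp add: mult.commute vec_of_zero)
  finally have "f \<in> relation_module ms" by (simp add: relation_module_def f_def)
  then have "\<phi> f = 0" by (rule \<phi>_zero)
  moreover have "(\<Sum>j<?n. \<alpha> j * restrict_keys R (p j)) = restrict_keys R (mon u)"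
    unfolding \<alpha>(1) using \<alpha>(2) by (rule restrict_const)
  moreover have "(\<Sum>j<?n. \<beta> j * restrict_keys R (p j)) = restrict_keys R (mon w)"
    unfolding \<beta>(1) using \<beta>(2) by (rule restrict_const)
  ultimately have "mon w * restrict_keys R (mon u) - mon u * restrict_keys R (mon w) = (0 :: ('n, 'k) polyring)"
    by (simp only: \<phi>_def f_sum)
  then have "(mon (w + u) :: ('n, 'k) polyring) = 0"
    using u(2) w(2) by (simp add: restrict_keys_single mult_single)
  then show False
    by (metis lookup_single_eq lookup_zero zero_neq_one)
qed

section \<open>Components of the graph\<close>

lemma num_nonisolated_components_eq_1_iff:
  fixes E :: "'n::finite set set"
  assumes "simple_graph E"
  shows "num_nonisolated_components E = 1 \<longleftrightarrow>
    E \<noteq> {} \<and> (\<forall>u\<in>\<Union>E. \<forall>v\<in>\<Union>E. (u, v) \<in> (adjacency E)\<^sup>*)"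
proof -
  let ?r = "(adjacency E)\<^sup>*"
  have isolated: "isolated_vertex E v \<longleftrightarrow> v \<notin> \<Union>E" for v by (auto simp: isolated_vertex_def)
  have class_isolated: "?r `` {v} = {v}" if "v \<notin> \<Union>E" for v
  proof -
    have "y = v" if "(v, y) \<in> ?r" for y
      using that by (rule converse_rtranclE) (use \<open>v \<notin> \<Union>E\<close> in \<open>auto simp: adjacency_def\<close>)
    then show ?thesis by auto
  qed
  have "{C \<in> connected_components E. \<not> (\<exists>v. isolated_vertex E v \<and> C = {v})} = (\<lambda>v. ?r `` {v}) ` \<Union>E"
  proof (intro equalityI subsetI)
    fix C assume "C \<in> {C \<in> connected_components E. \<not> (\<exists>v. isolated_vertex E v \<and> C = {v})}"
    then obtain v where v: "C = ?r `` {v}" "\<not> (\<exists>v. v \<notin> \<Union>E \<and> C = {v})"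
      unfolding isolated connected_components_def by (blast elim: quotientE)
    then have "v \<in> \<Union>E" using class_isolated by blast
    with v show "C \<in> (\<lambda>v. ?r `` {v}) ` \<Union>E" by blast
  next
    fix C assume "C \<in> (\<lambda>v. ?r `` {v}) ` \<Union>E"
    then obtain v where v: "v \<in> \<Union>E" "C = ?r `` {v}" by blast
    then have "v \<in> C" by blast
    then have "\<not> (\<exists>v. isolated_vertex E v \<and> C = {v})" using v(1) unfolding isolated by blast
    then show "C \<in> {C \<in> connected_components E. \<not> (\<exists>v. isolated_vertex E v \<and> C = {v})}"
      using v by (auto simp: connected_components_def intro: quotientI)
  qed
  then have num: "num_nonisolated_components E = card ((\<lambda>v. ?r `` {v}) ` \<Union>E)"
    by (simp add: num_nonisolated_components_def)
  show ?thesis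
  proof
    assume "num_nonisolated_components E = 1"
    then obtain K where K: "(\<lambda>v. ?r `` {v}) ` \<Union>E = {K}"
      unfolding num by (rule card_1_singletonE)
    then have "E \<noteq> {}" by auto
    moreover have "(u, v) \<in> ?r" if "u \<in> \<Union>E" "v \<in> \<Union>E" for u v
    proof -
      have "?r `` {u} \<in> {K}" "?r `` {v} \<in> {K}" unfolding K[symmetric] using that by simp_all
      then have "?r `` {u} = ?r `` {v}" by simp
      then show ?thesis by blast
    qed
    ultimately show "E \<noteq> {} \<and> (\<forall>u\<in>\<Union>E. \<forall>v\<in>\<Union>E. (u, v) \<in> ?r)" by blast
  next
    assume *: "E \<noteq> {} \<and> (\<forall>u\<in>\<Union>E. \<forall>v\<in>\<Union>E. (u, v) \<in> ?r)"
    then obtain e where e: "e \<in> E" by blast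
    then have "e \<noteq> {}" using assms by (auto simp: simple_graph_def)
    with e obtain u where u: "u \<in> \<Union>E" by blast
    have "?r `` {v} = ?r `` {u}" if "v \<in> \<Union>E" for v
    proof -
      have "(u, v) \<in> ?r" "(v, u) \<in> ?r" using * u that by blast+
      then show ?thesis by (auto intro: rtrancl_trans)
    qed
    then have "(\<lambda>v. ?r `` {v}) ` \<Union>E = {?r `` {u}}" using u by blast
    then show "num_nonisolated_components E = 1" by (simp add: num)
  qed
qed

text \<open>An edge lies inside a component or misses it, so it contributes \<open>2\<close> or \<open>0\<close>.\<close>

lemma sum_edge_degree_component:
  fixes E :: "'n::finite set set"
  assumes E: "simple_graph E" and C: "C = (adjacency E)\<^sup>* `` {x}" and M: "set_mset M \<subseteq> E"
  shows "(\<Sum>v\<in>C. edge_degree M v) = 2 * size {#e \<in># M. e \<subseteq> C#}"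
  using M
proof (induction M)
  case (add e M)
  have eE: "e \<in> E" using add.prems by simp
  then obtain i j where e: "e = {i, j}" "i \<noteq> j" using E by (auto simp: simple_graph_def card_2_iff)
  then have "(i, j) \<in> adjacency E" "(j, i) \<in> adjacency E"
    using eE by (auto simp: adjacency_def insert_commute)
  then have "i \<in> C \<longleftrightarrow> j \<in> C" unfolding C by (blast intro: rtrancl_into_rtrancl)
  then have "card (C \<inter> e) = (if e \<subseteq> C then 2 else 0)" using e by auto
  moreover have "(\<Sum>v\<in>C. edge_degree (add_mset e M) v) = card (C \<inter> e) + (\<Sum>v\<in>C. edge_degree M v)"
    unfolding sum_edge_degree by simp
  ultimately show ?case using add by (simp del: edge_degree_add_mset)
qed simp

lemma size_filter_replicate_mset: "size (filter_mset P (replicate_mset k x)) = (if P x then k else 0)"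
  by (induction k) auto

theorem linear_resolution_imp_connected:
  fixes E :: "'n::finite set set"
  assumes E: "simple_graph E" and k: "1 \<le> k"
    and res: "has_linear_resolution (ideal_power (complementary_edge_ideal E) k :: ('n, 'k::comm_ring_1) polyring set)"
  shows "num_nonisolated_components E = 1"
proof (rule ccontr)
  let ?I = "ideal_power (complementary_edge_ideal E) k :: ('n, 'k) polyring set"
  let ?T = "power_exponents E k"
  have I: "?I = ideal.span (mon ` ?T)" by (rule ideal_power_complementary_edge_ideal)
  have nonempty: "E \<noteq> {}"
  proof
    assume "E = {}"
    then have "?T = {}" using k by (auto simp: power_exponents_def)
    then have "syzygy_module ?I g 0 = {0}" for g
      unfolding I syzygy_module_0_eq by (simp add: vec_of_zero)
    then show False using res by (simp add: has_linear_resolution_def generated_in_degree_def del: syzygy_module.simps)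
  qed
  assume "num_nonisolated_components E \<noteq> 1"
  then obtain x y where xy: "x \<in> \<Union>E" "y \<in> \<Union>E" "(x, y) \<notin> (adjacency E)\<^sup>*"
    using nonempty unfolding num_nonisolated_components_eq_1_iff[OF E] by blast
  then obtain e f where e: "e \<in> E" "x \<in> e" and f: "f \<in> E" "y \<in> f" by blast
  define C where "C = (adjacency E)\<^sup>* `` {x}"
  note component_degree = sum_edge_degree_component[OF E C_def]
  have "e \<subseteq> C"
  proof
    fix z assume "z \<in> e"
    obtain x' where "e = {x, x'}" using other_endpoint[OF E e] by blast
    then have "(x, z) \<in> (adjacency E)\<^sup>*" using e(1) \<open>z \<in> e\<close> by (auto simp: adjacency_def)
    then show "z \<in> C" by (simp add: C_def)
  qed
  have "\<not> f \<subseteq> C" using f(2) xy(3) by (auto simp: C_def)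
  define comp_deg where "comp_deg t = (\<Sum>v\<in>C. Poly_Mapping.lookup t v)" for t :: "'n \<Rightarrow>\<^sub>0 nat"
  have comp_deg: "comp_deg t + 2 * size {#e \<in># M. e \<subseteq> C#} = k * card C"
    if "set_mset M \<subseteq> E" "\<And>v. Poly_Mapping.lookup t v + edge_degree M v = k" for t M
  proof -
    have "comp_deg t + (\<Sum>v\<in>C. edge_degree M v) = k * card C"
      by (simp add: comp_deg_def that(2) flip: sum.distrib)
    then show ?thesis by (simp add: component_degree[OF that(1)])
  qed
  have e_multiset: "set_mset (replicate_mset k e) \<subseteq> E" and f_multiset: "set_mset (replicate_mset k f) \<subseteq> E"
    using e f by auto
  obtain u where u: "u \<in> ?T" "\<And>v. Poly_Mapping.lookup u v + edge_degree (replicate_mset k e) v = k"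
    using power_exponents_of_multiset[OF e_multiset] by auto
  obtain w where w: "w \<in> ?T" "\<And>v. Poly_Mapping.lookup w v + edge_degree (replicate_mset k f) v = k"
    using power_exponents_of_multiset[OF f_multiset] by auto
  \<comment> \<open>on generators, \<open>comp_deg\<close> is either \<open>k * card C - 2 * k\<close> or larger by at least \<open>2\<close>\<close>
  let ?R = "\<lambda>t. comp_deg t + 2 * k \<le> k * card C"
  let ?Q = "\<lambda>t. comp_deg t + 2 * k \<le> Suc (k * card C)"
  have "\<not> has_linear_resolution ?I"
  proof (rule split_generators_imp_no_linear_resolution[OF I total_degree_power_exponents[OF E],
        where Q = ?Q and R = ?R])
    fix s t :: "'n \<Rightarrow>\<^sub>0 nat" assume s: "total_degree s = 1" and t: "t \<in> ?T"
    have "comp_deg s \<le> total_degree s"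
      unfolding comp_deg_def total_degree_def by (rule sum_mono2) auto
    then have "comp_deg s \<le> 1" using s by simp
    moreover have "comp_deg (s + t) = comp_deg s + comp_deg t"
      by (simp add: comp_deg_def lookup_add sum.distrib)
    moreover obtain M where M: "set_mset M \<subseteq> E" "\<And>v. Poly_Mapping.lookup t v + edge_degree M v = k"
      using t unfolding power_exponents_def by blast
    note comp_deg[OF M]
    moreover have "c + 2 * k \<le> Suc K \<longleftrightarrow> b + 2 * k \<le> K"
      if "a \<le> 1" "c = a + b" "b + 2 * q = K" for a b c q K :: nat
      using that by presburger
    ultimately show "?Q (s + t) \<longleftrightarrow> ?R t" by blast
  next
    show "u \<in> ?T" "w \<in> ?T" using u w by auto
    show "?R u" using comp_deg[OF e_multiset u(2)] \<open>e \<subseteq> C\<close>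
      by (simp add: size_filter_replicate_mset)
    show "\<not> ?R w" using comp_deg[OF f_multiset w(2)] \<open>\<not> f \<subseteq> C\<close> k
      by (simp add: size_filter_replicate_mset)
  qed
  with res show False by blast
qed

section \<open>The characterisation\<close>

theorem corollary4p8:
  fixes E :: "'n::finite set set"
    and I :: "('n, 'k::field) polyring set"
  assumes "simple_graph E"
    and "I = complementary_edge_ideal E"
  shows "((\<exists>k\<ge>1. has_linear_resolution (ideal_power I k)) \<longleftrightarrow>
          (\<forall>k\<ge>1. has_linear_resolution (ideal_power I k))) \<and>
         ((\<exists>k\<ge>1. has_linear_quotients (ideal_power I k)) \<longleftrightarrow>
          (\<forall>k\<ge>1. has_linear_quotients (ideal_power I k))) \<and>
         ((\<exists>k\<ge>1. has_linear_resolution (ideal_power I k)) \<longleftrightarrow>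
          (\<exists>k\<ge>1. has_linear_quotients (ideal_power I k))) \<and>
         ((\<exists>k\<ge>1. has_linear_quotients (ideal_power I k)) \<longleftrightarrow>
          num_nonisolated_components E = 1)"
proof -
  have c_to_b: "has_linear_quotients (ideal_power I k)" if c: "num_nonisolated_components E = 1" for k
  proof -
    from c have E: "E \<noteq> {}" "\<And>u v. u \<in> \<Union>E \<Longrightarrow> v \<in> \<Union>E \<Longrightarrow> (u, v) \<in> (adjacency E)\<^sup>*"
      unfolding num_nonisolated_components_eq_1_iff[OF assms(1)] by blast+
    then obtain e where "e \<in> E" by blast
    moreover from this have "e \<noteq> {}" using assms(1) by (auto simp: simple_graph_def)
    ultimately obtain root where "root \<in> \<Union>E" by blast
    then show ?thesis
      unfolding assms(2) using connected_imp_linear_quotients[OF assms(1) E(1)] E(2) by blast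
  qed
  have b_to_a: "has_linear_resolution (ideal_power I k)" if "has_linear_quotients (ideal_power I k)" for k
    using linear_quotients_imp_linear_resolution[OF _ total_degree_power_exponents[OF assms(1)] that]
    by (simp add: assms(2) ideal_power_complementary_edge_ideal)
  have a_to_c: "num_nonisolated_components E = 1" if "1 \<le> k" "has_linear_resolution (ideal_power I k)" for k
    using linear_resolution_imp_connected[OF assms(1) that(1)] that(2) unfolding assms(2) by blast
  show ?thesis using c_to_b b_to_a a_to_c by (meson order_refl)
qed

end
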